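(* Let $\mathcal U$ be a universal Martin-Löf test. There is a $\Sigma^0_2$ set $\mathcal A\subseteq 2^\omega$ such that $\chi_{\mathcal A}\restriction\mathrm{MLR}\not\le_{\mathrm W}\mathsf{LAY}_{\mathcal U}$.
   Context: Cantor space $2^\omega$, Lebesgue measure $\lambda$. A Martin-Löf (ML) test is a sequence $(\mathcal V_i)_{i\in\omega}$ of open subsets of $2^\omega$ such that $\{\langle i,\sigma\rangle:[\sigma]\subseteq\mathcal V_i\}$ is c.e. and $\lambda(\mathcal V_i)\le 2^{-i}$; it is universal if $\bigcap_i\mathcal V'_i\subseteq\bigcap_i\mathcal V_i$ for every ML-test $\mathcal V'$. $\mathrm{MLR}$ is the set of Martin-Löf random sequences. A set $\mathcal A\subseteq 2^\omega$ is $\Sigma^0_2$ if it is definable in the form $\{X:\exists s_0\,\forall s>s_0\,R(X,s)\}$ for a computable (oracle) predicate $R$, equivalently $\mathcal A=\bigcup_i[T_i]$ for a uniformly computable sequence of trees $T_i\subseteq 2^{<\omega}$. $\chi_{\mathcal A}$ is the characteristic function of $\mathcal A$, with values in $\{0,1\}\subseteq\omega$. A representation of a set $X$ is a surjective partial map $\delta_X:\subseteq\omega^\omega\to X$. A realizer of a multi-valued partial function $f:\subseteq X\rightrightarrows Y$ is a partial $\Gamma:\subseteq\omega^\omega\to\omega^\omega$ with $\delta_Y(\Gamma(p))\in f(\delta_X(p))$ for all $p\in\mathrm{dom}(f\circ\delta_X)$. $f\le_{\mathrm W} g$ if there are Turing functionals $\Phi,\Psi$ such that $p\mapsto\Psi(\langle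 p,\Gamma(\Phi(p))\rangle)$ realizes $f$ for every realizer $\Gamma$ of $g$. $\mathrm{MLR}$ is represented by the identity on $\mathrm{MLR}\subseteq\omega^\omega$, $\omega$ by $\chi_{\{n\}}\mapsto n$. $\mathsf{LAY}_{\mathcal U}\colon\mathrm{MLR}\rightrightarrows\omega$, $\mathsf{LAY}_{\mathcal U}(X)=\{i:X\notin\mathcal U_i\}$. *)

theory Defs
  imports "HOL-Probability.Probability"
begin

datatype rf = Z | S | Proj nat | Comp rf "rf list" | Prim rf rf | Mn rf | Orc

definition arg :: "nat \<Rightarrow> nat list \<Rightarrow> nat" where
  "arg k xs = (if k < length xs then xs ! k else 0)"

inductive ev :: "(nat \<Rightarrow> nat) \<Rightarrow> rf \<Rightarrow> nat list \<Rightarrow> nat \<Rightarrow> bool" for X where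
  ev_Z: "ev X Z xs 0"
| ev_S: "ev X S xs (Suc (arg 0 xs))"
| ev_Proj: "ev X (Proj k) xs (arg k xs)"
| ev_Orc: "ev X Orc xs (X (arg 0 xs))"
| ev_Comp: "length ys = length gs \<Longrightarrow> (\<forall>j<length gs. ev X (gs ! j) xs (ys ! j))
              \<Longrightarrow> ev X f ys y \<Longrightarrow> ev X (Comp f gs) xs y"
| ev_Prim0: "ev X f xs y \<Longrightarrow> ev X (Prim f g) (0 # xs) y"
| ev_PrimS: "ev X (Prim f g) (n # xs) r \<Longrightarrow> ev X g (n # r # xs) y
              \<Longrightarrow> ev X (Prim f g) (Suc n # xs) y"
| ev_Mn: "ev X f (n # xs) 0 \<Longrightarrow> (\<forall>m<n. \<exists>y. ev X f (m # xs) (Suc y))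
              \<Longrightarrow> ev X (Mn f) xs n"

definition TF :: "rf \<Rightarrow> (nat \<Rightarrow> nat) \<Rightarrow> (nat \<Rightarrow> nat) option" where
  "TF c p = (if \<exists>q. \<forall>n. ev p c [n] (q n)
             then Some (THE q. \<forall>n. ev p c [n] (q n)) else None)"

abbreviation noorc :: "nat \<Rightarrow> nat" where "noorc \<equiv> (\<lambda>_. 0)"

text \<open>Coding of binary strings by natural numbers (a bijection).\<close>
fun code :: "bool list \<Rightarrow> nat" where
  "code [] = 0"
| "code (b # bs) = 2 * code bs + 1 + (if b then 1 else 0)"

definition ce_pairs :: "(nat \<times> bool list) set \<Rightarrow> bool" where
  "ce_pairs W \<longleftrightarrow> (\<exists>c. \<forall>i \<sigma>. (i, \<sigma>) \<in> W \<longleftrightarrow> (\<exists>y. ev noorc c [i, code \<sigma>] y))"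

definition cyl :: "bool list \<Rightarrow> (nat \<Rightarrow> bool) set" where
  "cyl \<sigma> = {X. \<forall>k<length \<sigma>. X k = \<sigma> ! k}"

definition lam :: "(nat \<Rightarrow> bool) measure" where
  "lam = PiM UNIV (\<lambda>_. measure_pmf (bernoulli_pmf (1/2)))"

definition MLtest :: "(nat \<Rightarrow> (nat \<Rightarrow> bool) set) \<Rightarrow> bool" where
  "MLtest V \<longleftrightarrow> (\<forall>i. open (V i)) \<and> ce_pairs {(i, \<sigma>). cyl \<sigma> \<subseteq> V i}
      \<and> (\<forall>i. emeasure lam (V i) \<le> ennreal ((1/2) ^ i))"

definition universal_MLtest :: "(nat \<Rightarrow> (nat \<Rightarrow> bool) set) \<Rightarrow> bool" where
  "universal_MLtest U \<longleftrightarrow> MLtest U \<and> (\<forall>V. MLtest V \<longrightarrow> (\<Inter>i. V i) \<subseteq> (\<Inter>i. U i))"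

definition MLR :: "(nat \<Rightarrow> bool) set" where
  "MLR = {X. \<forall>V. MLtest V \<longrightarrow> X \<notin> (\<Inter>i. V i)}"

definition is_tree :: "bool list set \<Rightarrow> bool" where
  "is_tree T \<longleftrightarrow> (\<forall>\<sigma> \<tau>. \<sigma> @ \<tau> \<in> T \<longrightarrow> \<sigma> \<in> T)"

definition paths :: "bool list set \<Rightarrow> (nat \<Rightarrow> bool) set" where
  "paths T = {X. \<forall>n. map X [0..<n] \<in> T}"

definition Sigma02 :: "(nat \<Rightarrow> bool) set \<Rightarrow> bool" where
  "Sigma02 A \<longleftrightarrow> (\<exists>T :: nat \<Rightarrow> bool list set. (\<forall>i. is_tree (T i))
      \<and> (\<exists>c. \<forall>i \<sigma>. ev noorc c [i, code \<sigma>] (if \<sigma> \<in> T i then 1 else 0))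
      \<and> A = (\<Union>i. paths (T i)))"

text \<open>Baire space points are nat => nat; a representation is a partial surjection,
  modelled as (nat => nat) => 'a option.\<close>

definition pairB :: "(nat \<Rightarrow> nat) \<Rightarrow> (nat \<Rightarrow> nat) \<Rightarrow> (nat \<Rightarrow> nat)" where
  "pairB p q = (\<lambda>n. if even n then p (n div 2) else q (n div 2))"

definition to_cantor :: "(nat \<Rightarrow> nat) \<Rightarrow> (nat \<Rightarrow> bool)" where
  "to_cantor p = (\<lambda>n. p n = 1)"

definition MLR_B :: "(nat \<Rightarrow> nat) set" where
  "MLR_B = {p. (\<forall>n. p n \<in> {0, 1}) \<and> to_cantor p \<in> MLR}"

definition delta_MLR :: "(nat \<Rightarrow> nat) \<Rightarrow> (nat \<Rightarrow> nat) option" where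
  "delta_MLR p = (if p \<in> MLR_B then Some p else None)"

definition chi_nat :: "nat \<Rightarrow> (nat \<Rightarrow> nat)" where
  "chi_nat n = (\<lambda>k. if k = n then 1 else 0)"

definition delta_nat :: "(nat \<Rightarrow> nat) \<Rightarrow> nat option" where
  "delta_nat p = (if \<exists>n. p = chi_nat n then Some (THE n. p = chi_nat n) else None)"

text \<open>Gamma realizes the multi-valued partial function F with domain D.\<close>
definition realizes ::
  "((nat \<Rightarrow> nat) \<Rightarrow> 'a option) \<Rightarrow> ((nat \<Rightarrow> nat) \<Rightarrow> 'b option) \<Rightarrow> 'a set \<Rightarrow> ('a \<Rightarrow> 'b set)
   \<Rightarrow> ((nat \<Rightarrow> nat) \<Rightarrow> (nat \<Rightarrow> nat) option) \<Rightarrow> bool" where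
  "realizes dX dY D F \<Gamma> \<longleftrightarrow> (\<forall>p x. dX p = Some x \<and> x \<in> D \<longrightarrow>
      (\<exists>q y. \<Gamma> p = Some q \<and> dY q = Some y \<and> y \<in> F x))"

definition weihrauch_le ::
  "((nat \<Rightarrow> nat) \<Rightarrow> 'a option) \<Rightarrow> ((nat \<Rightarrow> nat) \<Rightarrow> 'b option) \<Rightarrow> 'a set \<Rightarrow> ('a \<Rightarrow> 'b set)
   \<Rightarrow> ((nat \<Rightarrow> nat) \<Rightarrow> 'c option) \<Rightarrow> ((nat \<Rightarrow> nat) \<Rightarrow> 'd option) \<Rightarrow> 'c set \<Rightarrow> ('c \<Rightarrow> 'd set)
   \<Rightarrow> bool" where
  "weihrauch_le dX dY D F dZ dW E G \<longleftrightarrow> (\<exists>\<Phi> \<Psi>. \<forall>\<Gamma>. realizes dZ dW E G \<Gamma> \<longrightarrow>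
      realizes dX dY D F (\<lambda>p. case TF \<Phi> p of None \<Rightarrow> None
                               | Some p' \<Rightarrow> (case \<Gamma> p' of None \<Rightarrow> None
                                            | Some r \<Rightarrow> TF \<Psi> (pairB p r))))"

definition LAY :: "(nat \<Rightarrow> (nat \<Rightarrow> bool) set) \<Rightarrow> (nat \<Rightarrow> nat) \<Rightarrow> nat set" where
  "LAY U X = {i. to_cantor X \<notin> U i}"

definition chi_restr :: "(nat \<Rightarrow> bool) set \<Rightarrow> (nat \<Rightarrow> nat) \<Rightarrow> nat set" where
  "chi_restr A X = {if to_cantor X \<in> A then 1 else 0}"

end

theory Submission
  imports Defs "HOL-Library.Sublist"
begin

text \<open>Let \<open>W\<close> be the set of strings \<open>\<sigma>\<close> with \<open>[\<sigma>] \<subseteq> U\<^sub>1\<close> and let \<open>A\<close> consist of the \<open>X\<close> only finitely many of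
  whose initial segments have a child in \<open>W\<close>; enumerating \<open>W\<close> in stages shows that \<open>A\<close> is
  \<open>\<Sigma>\<^sup>0\<^sub>2\<close>. The set \<open>K = - U\<^sub>1\<close> is closed, has positive measure and contains only random sequences.
  Each nonempty relatively open part of \<open>K\<close> has positive measure, because a null effectively closed
  set has no random elements. By Borel-Cantelli almost every element of \<open>K\<close> is in \<open>A\<close>, so
  \<open>A\<close> is dense in \<open>K\<close>. So is its complement, by a Baire category argument: no cylinder consists of
  random sequences only, hence above every extendible string there is one with a child in \<open>W\<close>.

  A reduction \<open>\<Phi>, \<Psi>\<close> would cover \<open>K\<close> by the relatively closed sets \<open>{X. \<Phi>(X) \<notin> U\<^sub>i}\<close>, on each of which
  \<open>\<chi>\<^sub>A\<close> is continuous. By Baire category one of them contains a nonempty relatively open part of \<open>K\<close>,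
  where \<open>A\<close> and its complement are both dense: a contradiction.\<close>

section \<open>Computable functions and decidable predicates\<close>

text \<open>Functions take one argument list of fixed length: variables are its entries and a bound
  variable is put in front, so each construct gets a single closure rule.\<close>

definition computable :: "nat \<Rightarrow> (nat list \<Rightarrow> nat) \<Rightarrow> bool" where
  "computable k f \<longleftrightarrow> (\<exists>c. \<forall>xs. length xs = k \<longrightarrow> ev noorc c xs (f xs))"

definition decidable :: "nat \<Rightarrow> (nat list \<Rightarrow> bool) \<Rightarrow> bool" where
  "decidable k P \<longleftrightarrow> computable k (\<lambda>xs. if P xs then 1 else 0)"

lemma computable_cong:
  assumes "computable k f" "\<And>xs. length xs = k \<Longrightarrow> f xs = g xs"
  shows "computable k g"
  using assms by (force simp: computable_def)

lemma computable_comp: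
  assumes "computable (length gs) f" "\<And>g. g \<in> set gs \<Longrightarrow> computable k g"
  shows "computable k (\<lambda>xs. f (map (\<lambda>g. g xs) gs))"
proof -
  obtain c where c: "\<And>xs. length xs = length gs \<Longrightarrow> ev noorc c xs (f xs)"
    using assms(1) by (auto simp: computable_def)
  have "\<forall>g\<in>set gs. \<exists>d. \<forall>xs. length xs = k \<longrightarrow> ev noorc d xs (g xs)"
    using assms(2) by (auto simp: computable_def)
  then obtain d where d: "\<And>g xs. g \<in> set gs \<Longrightarrow> length xs = k \<Longrightarrow> ev noorc (d g) xs (g xs)"
    by metis
  have "ev noorc (Comp c (map d gs)) xs (f (map (\<lambda>g. g xs) gs))" if "length xs = k" for xs
    by (rule ev_Comp[where ys = "map (\<lambda>g. g xs) gs"]) (auto intro!: c d that)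
  then show ?thesis unfolding computable_def by blast
qed

lemma computable_prim:
  assumes "computable k f" "computable (Suc (Suc k)) g"
  shows "computable (Suc k) (\<lambda>zs. rec_nat (f (tl zs)) (\<lambda>n r. g (n # r # tl zs)) (hd zs))"
proof -
  obtain c where c: "\<And>xs. length xs = k \<Longrightarrow> ev noorc c xs (f xs)"
    using assms(1) by (auto simp: computable_def)
  obtain d where d: "\<And>xs. length xs = Suc (Suc k) \<Longrightarrow> ev noorc d xs (g xs)"
    using assms(2) by (auto simp: computable_def)
  have *: "ev noorc (Prim c d) (n # xs) (rec_nat (f xs) (\<lambda>n r. g (n # r # xs)) n)"
    if "length xs = k" for n xs
  proof (induction n)
    case 0
    then show ?case using c[OF that] by (auto intro: ev_Prim0)
  next
    case (Suc n)
    then show ?case using d that by (auto intro!: ev_PrimS[OF Suc])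
  qed
  have "ev noorc (Prim c d) zs (rec_nat (f (tl zs)) (\<lambda>n r. g (n # r # tl zs)) (hd zs))"
    if "length zs = Suc k" for zs
    using *[of "tl zs" "hd zs"] that by (cases zs) auto
  then show ?thesis unfolding computable_def by blast
qed

text \<open>Serves to rearrange arguments: \<open>computable_subst\<close> feeds a function any list
  built from \<open>xs\<close> by cons, \<open>tl\<close> and indexing.\<close>

definition computable_tuple :: "nat \<Rightarrow> nat \<Rightarrow> (nat list \<Rightarrow> nat list) \<Rightarrow> bool" where
  "computable_tuple k n F \<longleftrightarrow> (\<forall>xs. length xs = k \<longrightarrow> length (F xs) = n) \<and>
    (\<forall>j<n. computable k (\<lambda>xs. F xs ! j))"

lemma computable_nth: "computable_tuple k n F \<Longrightarrow> j < n \<Longrightarrow> computable k (\<lambda>xs. F xs ! j)"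
  by (simp add: computable_tuple_def)

lemma computable_subst:
  assumes "computable n f" "computable_tuple k n F"
  shows "computable k (\<lambda>xs. f (F xs))"
proof (rule computable_cong)
  show "computable k (\<lambda>xs. f (map (\<lambda>g. g xs) (map (\<lambda>j xs. F xs ! j) [0..<n])))"
    using assms by (intro computable_comp) (auto simp: computable_tuple_def)
  fix xs :: "nat list" assume "length xs = k"
  then have "length (F xs) = n" using assms by (simp add: computable_tuple_def)
  then show "f (map (\<lambda>g. g xs) (map (\<lambda>j xs. F xs ! j) [0..<n])) = f (F xs)"
    by (simp add: comp_def) (metis map_nth)
qed

lemma computable_tuple_id: "computable_tuple k k (\<lambda>xs. xs)"
  unfolding computable_tuple_def computable_def
proof (intro conjI allI impI exI)
  fix xs :: "nat list" and j assume "j < k" "length xs = k"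
  then show "ev noorc (Proj j) xs (xs ! j)" using ev_Proj[of noorc j xs] by (simp add: arg_def)
qed simp

lemma computable_tuple_Cons:
  "computable k f \<Longrightarrow> computable_tuple k n F \<Longrightarrow> computable_tuple k (Suc n) (\<lambda>xs. f xs # F xs)"
  by (auto simp: computable_tuple_def less_Suc_eq_0_disj)

lemma computable_tuple_tl:
  assumes "computable_tuple k (Suc n) F"
  shows "computable_tuple k n (\<lambda>xs. tl (F xs))"
proof -
  have "computable k (\<lambda>xs. tl (F xs) ! j)" if "j < n" for j
    using assms that
    by (intro computable_cong[OF computable_nth[OF assms, of "Suc j"]]) (auto simp: nth_tl computable_tuple_def)
  then show ?thesis using assms by (auto simp: computable_tuple_def)
qed

lemma computable_hd:
  assumes "computable_tuple k (Suc n) F"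
  shows "computable k (\<lambda>xs. hd (F xs))"
proof (rule computable_cong[OF computable_nth[OF assms, of 0]])
  fix xs :: "nat list" assume "length xs = k"
  then have "length (F xs) = Suc n" using assms by (simp add: computable_tuple_def)
  then show "F xs ! 0 = hd (F xs)" by (cases "F xs") auto
qed simp

lemmas tuple_intros = computable_tuple_id computable_tuple_Cons computable_tuple_tl computable_nth computable_hd

section \<open>Arithmetic, bounded sums and bounded quantifiers\<close>

lemma computable_comp1:
  "computable (Suc 0) (\<lambda>xs. f (xs ! 0)) \<Longrightarrow> computable k g \<Longrightarrow> computable k (\<lambda>xs. f (g xs))"
  using computable_comp[of "[g]" "\<lambda>xs. f (xs ! 0)" k] by simp

lemma computable_Suc:
  assumes "computable k f" shows "computable k (\<lambda>xs. Suc (f xs))"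
proof (rule computable_comp1[OF _ assms])
  have "ev noorc S xs (Suc (xs ! 0))" if "length xs = Suc 0" for xs :: "nat list"
    using ev_S[of noorc xs] that by (simp add: arg_def)
  then show "computable (Suc 0) (\<lambda>xs. Suc (xs ! 0))" unfolding computable_def by blast
qed

lemma computable_const: "computable k (\<lambda>xs. n)"
proof (induction n)
  case 0
  then show ?case using ev_Z by (auto simp: computable_def)
qed (rule computable_Suc)

lemma computable_weaken:
  "computable k f \<Longrightarrow> computable (Suc k) (\<lambda>zs. f (tl zs))"
  by (rule computable_subst[OF _ computable_tuple_tl[OF computable_tuple_id]])

text \<open>\<open>Prim\<close> recurses on the first argument, so the bound \<open>b xs\<close> is
  substituted there. The parameters sit behind the counter and the previous value.\<close>

lemma computable_rec:
  assumes "computable k b" "computable k f"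
    "computable (Suc (Suc k)) (\<lambda>zs. g (tl (tl zs)) (zs ! 0) (zs ! 1))"
  shows "computable k (\<lambda>xs. rec_nat (f xs) (g xs) (b xs))"
proof -
  have "computable (Suc k) (\<lambda>zs. rec_nat (f (tl zs)) (\<lambda>n r. g (tl zs) n r) (hd zs))"
    using computable_prim[OF assms(2,3)] by simp
  from computable_subst[OF this computable_tuple_Cons[OF assms(1) computable_tuple_id]]
  show ?thesis by simp
qed

lemma computable_add:
  assumes "computable k f" "computable k g"
  shows "computable k (\<lambda>xs. f xs + g xs)"
proof -
  have "computable k (\<lambda>xs. rec_nat (g xs) (\<lambda>_ r. Suc r) (f xs))"
    by (rule computable_rec assms computable_Suc tuple_intros | simp)+
  moreover have "rec_nat b (\<lambda>_ r. Suc r) a = a + b" for a b :: nat by (induction a) auto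
  ultimately show ?thesis by simp
qed

lemma computable_sum:
  assumes "computable k b" "computable (Suc k) (\<lambda>zs. f (tl zs) (hd zs))"
  shows "computable k (\<lambda>xs. \<Sum>y<b xs. f xs y)"
proof -
  have "computable (Suc (Suc k)) (\<lambda>zs. (\<lambda>zs. f (tl zs) (hd zs)) (zs ! 0 # tl (tl zs)))"
    by (rule computable_subst[OF assms(2)]) (rule tuple_intros | simp)+
  then have *: "computable (Suc (Suc k)) (\<lambda>zs. f (tl (tl zs)) (zs ! 0))" by simp
  have "computable k (\<lambda>xs. rec_nat 0 (\<lambda>y r. r + f xs y) (b xs))"
    by (rule computable_rec * assms(1) computable_add computable_const tuple_intros | simp)+
  moreover have "rec_nat 0 (\<lambda>y r. r + f xs y) n = (\<Sum>y<n. f xs y)" for xs n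
    by (induction n) auto
  ultimately show ?thesis by (simp only:)
qed

lemma computable_mult:
  assumes "computable k f" "computable k g"
  shows "computable k (\<lambda>xs. f xs * g xs)"
  using computable_sum[of k f "\<lambda>xs _. g xs", OF assms(1) computable_weaken[OF assms(2)]] by simp

lemma computable_diff:
  assumes "computable k f" "computable k g"
  shows "computable k (\<lambda>xs. f xs - g xs)"
proof -
  have *: "rec_nat 0 (\<lambda>n r. n) m = m - 1" for m :: nat by (cases m) auto
  have pred: "computable k (\<lambda>xs. h xs - 1)" if "computable k h" for h k
    using computable_rec[OF that computable_const[of _ 0], of "\<lambda>_ n r. n", unfolded *]
      computable_nth[OF computable_tuple_id] by blast
  have **: "rec_nat a (\<lambda>_ r. r - 1) b = a - b" for a b :: nat by (induction b) auto
  have "computable k (\<lambda>xs. rec_nat (f xs) (\<lambda>_ r. r - 1) (g xs))"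
    by (rule computable_rec assms pred tuple_intros | simp)+
  then show ?thesis by (simp only: **)
qed

lemma computable_power:
  assumes "computable k f" "computable k g"
  shows "computable k (\<lambda>xs. f xs ^ g xs)"
proof -
  have *: "computable (Suc (Suc k)) (\<lambda>zs. f (tl (tl zs)))"
    by (intro computable_weaken[of "Suc k" "\<lambda>zs. f (tl zs)"] computable_weaken assms)
  have "computable k (\<lambda>xs. rec_nat 1 (\<lambda>_ r. f xs * r) (g xs))"
    by (rule computable_rec * assms(2) computable_mult computable_const tuple_intros | simp)+
  moreover have "rec_nat 1 (\<lambda>_ r. a * r) b = a ^ b" for a b :: nat by (induction b) auto
  ultimately show ?thesis by simp
qed

text \<open>With truncated subtraction, \<open>1 - (f xs - g xs)\<close> is the characteristic
  function.\<close>

lemma decidable_le: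
  assumes "computable k f" "computable k g"
  shows "decidable k (\<lambda>xs. f xs \<le> g xs)"
  unfolding decidable_def
  by (rule computable_cong[OF computable_diff[OF computable_const[of k 1] computable_diff[OF assms]]]) auto

lemma decidable_conj:
  assumes "decidable k P" "decidable k Q"
  shows "decidable k (\<lambda>xs. P xs \<and> Q xs)"
  using computable_mult[OF assms[unfolded decidable_def]] unfolding decidable_def
  by (rule computable_cong) auto

lemma decidable_not:
  assumes "decidable k P"
  shows "decidable k (\<lambda>xs. \<not> P xs)"
  using computable_diff[OF computable_const[of k 1] assms[unfolded decidable_def]] unfolding decidable_def
  by (rule computable_cong) auto

lemma decidable_disj:
  assumes "decidable k P" "decidable k Q"
  shows "decidable k (\<lambda>xs. P xs \<or> Q xs)"
  using decidable_not[OF decidable_conj[OF decidable_not[OF assms(1)] decidable_not[OF assms(2)]]]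
  by simp

lemma decidable_imp:
  assumes "decidable k P" "decidable k Q"
  shows "decidable k (\<lambda>xs. P xs \<longrightarrow> Q xs)"
  using decidable_disj[OF decidable_not[OF assms(1)] assms(2)] by (simp only: imp_conv_disj)

lemma decidable_eq:
  assumes "computable k f" "computable k g"
  shows "decidable k (\<lambda>xs. f xs = g xs)"
  using decidable_conj[OF decidable_le[OF assms] decidable_le[OF assms(2,1)]] by (simp add: eq_iff)

lemma decidable_less:
  assumes "computable k f" "computable k g"
  shows "decidable k (\<lambda>xs. f xs < g xs)"
  using decidable_not[OF decidable_le[OF assms(2,1)]] by (simp add: not_le)

lemma computable_if:
  assumes "decidable k P" "computable k f" "computable k g"
  shows "computable k (\<lambda>xs. if P xs then f xs else g xs)"
  using computable_add[OF computable_mult[OF assms(1)[unfolded decidable_def] assms(2)]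
      computable_mult[OF decidable_not[OF assms(1), unfolded decidable_def] assms(3)]]
  by (rule computable_cong) auto

text \<open>The witnesses are counted by a computable sum, and it is tested whether the count is
  positive.\<close>

lemma decidable_ex:
  assumes "computable k b" "decidable (Suc k) (\<lambda>zs. P (tl zs) (hd zs))"
  shows "decidable k (\<lambda>xs. \<exists>y<b xs. P xs y)"
proof -
  have "computable k (\<lambda>xs. \<Sum>y<b xs. if P xs y then 1 else 0)"
    using assms by (intro computable_sum) (auto simp: decidable_def)
  from decidable_less[OF computable_const[of k 0] this]
  have "decidable k (\<lambda>xs. 0 < (\<Sum>y<b xs. if P xs y then 1 else 0 :: nat))" .
  moreover have "0 < (\<Sum>y<n. if P xs y then 1 else 0 :: nat) \<longleftrightarrow> (\<exists>y<n. P xs y)" for xs n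
    by (induction n) (auto simp: less_Suc_eq)
  ultimately show ?thesis by simp
qed

lemma decidable_all:
  assumes "computable k b" "decidable (Suc k) (\<lambda>zs. P (tl zs) (hd zs))"
  shows "decidable k (\<lambda>xs. \<forall>y<b xs. P xs y)"
  using decidable_not[OF decidable_ex[OF assms(1), of "\<lambda>xs y. \<not> P xs y"]] decidable_not[OF assms(2)]
  by simp

named_theorems computable_intros
lemmas [computable_intros] = tuple_intros
  computable_Suc computable_const computable_add computable_sum computable_mult computable_diff
  computable_power computable_if decidable_le decidable_conj decidable_not decidable_disj decidable_imp
  decidable_eq decidable_less decidable_ex decidable_all

lemma decidable_const: "decidable k (\<lambda>xs. b)"
  by (cases b) (auto simp: decidable_def computable_const)

section \<open>Simulating programs in stages\<close>

text \<open>\<open>h (s # xs)\<close> is \<open>Suc y\<close> if the program has been seen to return \<open>y\<close> by stage \<open>s\<close>, and 0 before.\<close>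
definition simulates :: "nat \<Rightarrow> rf \<Rightarrow> (nat list \<Rightarrow> nat) \<Rightarrow> bool" where
  "simulates k c h \<longleftrightarrow> (\<forall>xs s t y. length xs = k \<longrightarrow> s \<le> t \<longrightarrow> h (s # xs) = Suc y \<longrightarrow> h (t # xs) = Suc y) \<and>
    (\<forall>xs y. length xs = k \<longrightarrow> (ev noorc c xs y \<longleftrightarrow> (\<exists>s. h (s # xs) = Suc y)))"

lemma simulatesD:
  assumes "simulates k c h" "length xs = k"
  shows "h (s # xs) = Suc y \<Longrightarrow> s \<le> t \<Longrightarrow> h (t # xs) = Suc y"
    "ev noorc c xs y \<longleftrightarrow> (\<exists>s. h (s # xs) = Suc y)"
  using assms unfolding simulates_def by blast+

text \<open>For the basic programs: since they always halt, their value can be reported at every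
  stage.\<close>

lemma simulates_total:
  assumes "\<And>xs y. length xs = k \<Longrightarrow> ev noorc c xs y \<longleftrightarrow> y = f xs"
  shows "simulates k c (\<lambda>zs. Suc (f (tl zs)))"
  using assms by (auto simp: simulates_def)

lemma ex_simulation_total:
  assumes "\<And>xs y. length xs = k \<Longrightarrow> ev noorc c xs y \<longleftrightarrow> y = f xs"
  shows "\<exists>h. computable (Suc k) h \<and> simulates k c h"
proof -
  have "computable k f" unfolding computable_def using assms by blast
  then show ?thesis using simulates_total[OF assms] by (blast intro: computable_Suc computable_weaken)
qed

inductive_cases ev_ZE: "ev X Z xs y"
inductive_cases ev_SE: "ev X S xs y"
inductive_cases ev_ProjE: "ev X (Proj k) xs y"
inductive_cases ev_OrcE: "ev X Orc xs y"
inductive_cases ev_CompE: "ev X (Comp f gs) xs y"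
inductive_cases ev_PrimE: "ev X (Prim f g) xs y"
inductive_cases ev_Prim0E: "ev X (Prim f g) (0 # xs) y"
inductive_cases ev_PrimSE: "ev X (Prim f g) (Suc n # xs) y"
inductive_cases ev_MnE: "ev X (Mn f) xs y"

text \<open>The sum of the individual thresholds is at least each of them. Used to merge stages of
  simulations and, in \<open>ev_use\<close> and \<open>TF_continuous\<close>, bounds on oracle
  queries.\<close>

lemma bounded_mono_ex:
  fixes n :: nat and Q :: "nat \<Rightarrow> nat \<Rightarrow> bool"
  assumes "\<And>j. j < n \<Longrightarrow> \<exists>s. Q j s" "\<And>j s t. j < n \<Longrightarrow> Q j s \<Longrightarrow> s \<le> t \<Longrightarrow> Q j t"
  shows "\<exists>s. \<forall>j<n. Q j s"
proof -
  obtain s where s: "\<And>j. j < n \<Longrightarrow> Q j (s j)" using assms(1) by metis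
  have "\<forall>j<n. Q j (\<Sum>i<n. s i)"
    using assms(2) s by (meson member_le_sum finite_lessThan lessThan_iff zero_le)
  then show ?thesis by blast
qed

lemma decidable_ball_list:
  "(\<And>g. g \<in> set gs \<Longrightarrow> decidable k (P g)) \<Longrightarrow> decidable k (\<lambda>xs. \<forall>g\<in>set gs. P g xs)"
proof (induction gs)
  case Nil
  then show ?case using decidable_const[of k True] by simp
next
  case (Cons a gs)
  then have "decidable k (\<lambda>xs. P a xs \<and> (\<forall>g\<in>set gs. P g xs))"
    by (intro decidable_conj) auto
  then show ?case by simp
qed

text \<open>By recursion on the program, so that no universal machine is needed.\<close>
lemma ex_simulation: "\<exists>h. computable (Suc k) h \<and> simulates k c h"
proof (induction c arbitrary: k)
  case Z
  then show ?case by (rule ex_simulation_total) (auto intro: ev_Z elim: ev_ZE)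
next
  case S
  then show ?case by (rule ex_simulation_total) (auto intro: ev_S elim: ev_SE)
next
  case (Proj j)
  then show ?case by (rule ex_simulation_total) (auto intro: ev_Proj elim: ev_ProjE)
next
  case Orc
  have "ev noorc Orc xs 0" for xs using ev_Orc[of noorc xs] by simp
  then show ?case by (intro ex_simulation_total[where f = "\<lambda>_. 0"]) (auto elim: ev_OrcE)
next
  case (Comp f gs)
  obtain hf where hf: "computable (Suc (length gs)) hf" "simulates (length gs) f hf"
    using Comp(1) by blast
  obtain H where H: "\<And>g. g \<in> set gs \<Longrightarrow> computable (Suc k) (H g)"
      "\<And>g. g \<in> set gs \<Longrightarrow> simulates k g (H g)"
    using bchoice[of "set gs" "\<lambda>g h. computable (Suc k) h \<and> simulates k g h"] Comp(2) by blast
  \<comment> \<open>All programs run with the same stage. \<open>H g zs - 1\<close> removes the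
    successor that marks a halted computation.\<close>
  define h where "h = (\<lambda>zs. if \<forall>g\<in>set gs. 0 < H g zs then hf (hd zs # map (\<lambda>g. H g zs - 1) gs) else 0)"
  have *: "computable_tuple (Suc k) (length gs) (\<lambda>zs. map (\<lambda>g. H g zs - 1) gs)"
    unfolding computable_tuple_def by (auto intro!: computable_diff computable_const H)
  have "computable (Suc k) h"
    unfolding h_def
    by (rule computable_if computable_subst[OF hf(1)] decidable_ball_list decidable_less computable_const H(1) * tuple_intros | assumption)+
  moreover have "simulates k (Comp f gs) h"
    unfolding simulates_def
  proof (intro conjI allI impI)
    fix xs :: "nat list" and s t y :: nat
    assume xs: "length xs = k" and st: "s \<le> t" and y: "h (s # xs) = Suc y"
    have pos: "0 < H g (s # xs)" if "g \<in> set gs" for g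
      using y that by (auto simp: h_def split: if_splits)
    have eq: "H g (t # xs) = H g (s # xs)" if "g \<in> set gs" for g
      using pos[OF that] simulatesD(1)[OF H(2)[OF that] xs _ st] by (cases "H g (s # xs)") auto
    have "hf (s # map (\<lambda>g. H g (s # xs) - 1) gs) = Suc y"
      using y by (auto simp: h_def split: if_splits)
    from simulatesD(1)[OF hf(2) _ this st]
    show "h (t # xs) = Suc y" using pos eq by (simp add: h_def cong: map_cong)
  next
    fix xs :: "nat list" and y :: nat
    assume xs: "length xs = k"
    show "ev noorc (Comp f gs) xs y \<longleftrightarrow> (\<exists>s. h (s # xs) = Suc y)"
    proof
      assume "ev noorc (Comp f gs) xs y"
      then obtain ys where ys: "length ys = length gs" "\<And>j. j < length gs \<Longrightarrow> ev noorc (gs ! j) xs (ys ! j)"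
        "ev noorc f ys y" by (auto elim: ev_CompE)
      have "\<exists>s. \<forall>j<length gs. H (gs ! j) (s # xs) = Suc (ys ! j)"
      proof (rule bounded_mono_ex)
        fix j assume "j < length gs"
        then show "\<exists>s. H (gs ! j) (s # xs) = Suc (ys ! j)"
          using simulatesD(2)[OF H(2) xs] ys(2) nth_mem by blast
      next
        fix j s t assume "j < length gs" "H (gs ! j) (s # xs) = Suc (ys ! j)" "s \<le> t"
        then show "H (gs ! j) (t # xs) = Suc (ys ! j)"
          using simulatesD(1)[OF H(2) xs] nth_mem by blast
      qed
      then obtain s where s: "\<And>j. j < length gs \<Longrightarrow> H (gs ! j) (s # xs) = Suc (ys ! j)" by blast
      obtain t where t: "hf (t # ys) = Suc y" using simulatesD(2)[OF hf(2) ys(1)] ys(3) by blast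
      have H': "H (gs ! j) (max s t # xs) = Suc (ys ! j)" if "j < length gs" for j
        using simulatesD(1)[OF H(2) xs s] that by auto
      have "map (\<lambda>g. H g (max s t # xs) - 1) gs = ys"
        using H' ys(1) by (auto intro: nth_equalityI)
      moreover have "\<forall>g\<in>set gs. 0 < H g (max s t # xs)"
        using H' by (auto simp: in_set_conv_nth)
      ultimately have "h (max s t # xs) = Suc y"
        using simulatesD(1)[OF hf(2) ys(1) t] by (simp add: h_def)
      then show "\<exists>s. h (s # xs) = Suc y" by blast
    next
      assume "\<exists>s. h (s # xs) = Suc y"
      then obtain s where y: "h (s # xs) = Suc y" by blast
      define ys where "ys = map (\<lambda>g. H g (s # xs) - 1) gs"
      have pos: "0 < H g (s # xs)" if "g \<in> set gs" for g
        using y that by (auto simp: h_def split: if_splits)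
      have "hf (s # ys) = Suc y"
        using y by (auto simp: h_def ys_def split: if_splits)
      then have "ev noorc f ys y" using simulatesD(2)[OF hf(2)] by (auto simp: ys_def)
      moreover have "ev noorc (gs ! j) xs (ys ! j)" if "j < length gs" for j
        using simulatesD(2)[OF H(2) xs] pos that unfolding ys_def
        by (metis Suc_pred' diff_Suc_1 length_map nth_map nth_mem)
      ultimately show "ev noorc (Comp f gs) xs y"
        by (intro ev_Comp[of ys]) (auto simp: ys_def)
    qed
  qed
  ultimately show ?case by blast
next
  case (Prim f g)
  show ?case
  proof (cases k)
    case 0
    \<comment> \<open>Without a first argument neither rule for \<open>Prim\<close> applies, so the
      program never halts.\<close>
    have "simulates k (Prim f g) (\<lambda>_. 0)"
      using 0 by (auto simp: simulates_def elim: ev_PrimE)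
    then show ?thesis using computable_const by blast
  next
    case (Suc m)
    obtain hf where hf: "computable (Suc m) hf" "simulates m f hf" using Prim(1) by blast
    obtain hg where hg: "computable (Suc (Suc (Suc m))) hg" "simulates (Suc (Suc m)) g hg"
      using Prim(2) by blast
    \<comment> \<open>A value 0 means that the recursion is still running at stage \<open>s\<close>,
      and it is passed on. A positive value is the result plus one, hence \<open>r - 1\<close> is
      fed to \<open>g\<close>.\<close>
    define r where "r s ys = rec_nat (hf (s # ys)) (\<lambda>n r. if r = 0 then 0 else hg (s # n # (r - 1) # ys))" for s ys
    define h where "h = (\<lambda>zs. r (hd zs) (tl (tl zs)) (hd (tl zs)))"
    have r_Suc: "r s ys (Suc n) = Suc y \<longleftrightarrow> (\<exists>z. r s ys n = Suc z \<and> hg (s # n # z # ys) = Suc y)" for s ys n y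
      by (cases "r s ys n") (auto simp: r_def)
    have r_0: "r s ys 0 = hf (s # ys)" for s ys by (simp add: r_def)
    have "computable (Suc k) h"
      unfolding h_def r_def Suc
    by (rule computable_rec computable_if decidable_eq computable_const tuple_intros
        computable_subst[OF hf(1)] computable_subst[OF hg(1)] computable_diff | simp)+
    moreover have mono: "r t ys n = Suc y" if "r s ys n = Suc y" "s \<le> t" "length ys = m" for s t ys n y
      using that(1)
    proof (induction n arbitrary: y)
      case 0
      then show ?case using simulatesD(1)[OF hf(2) that(3) _ that(2)] by (auto simp: r_0)
    next
      case (Suc n)
      then obtain z where z: "r s ys n = Suc z" "hg (s # n # z # ys) = Suc y" by (auto simp: r_Suc)
      have "hg (t # n # z # ys) = Suc y"
        by (rule simulatesD(1)[OF hg(2) _ z(2) that(2)]) (simp add: that)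
      then show ?case using Suc(1)[OF z(1)] by (auto simp: r_Suc)
    qed
    have r_ev: "ev noorc (Prim f g) (n # ys) y \<longleftrightarrow> (\<exists>s. r s ys n = Suc y)" if "length ys = m" for n ys y
    proof (induction n arbitrary: y)
      case 0
      have "ev noorc (Prim f g) (0 # ys) y \<longleftrightarrow> ev noorc f ys y"
        by (auto intro: ev_Prim0 elim: ev_Prim0E)
      then show ?case using simulatesD(2)[OF hf(2) that] by (simp add: r_0)
    next
      case (Suc n)
      have "ev noorc (Prim f g) (Suc n # ys) y \<longleftrightarrow>
          (\<exists>z. ev noorc (Prim f g) (n # ys) z \<and> ev noorc g (n # z # ys) y)"
        by (blast intro: ev_PrimS elim: ev_PrimSE)
      also have "\<dots> \<longleftrightarrow> (\<exists>z. (\<exists>s. r s ys n = Suc z) \<and> (\<exists>t. hg (t # n # z # ys) = Suc y))"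
      proof -
        have "ev noorc g (n # z # ys) y \<longleftrightarrow> (\<exists>t. hg (t # n # z # ys) = Suc y)" for z
          by (rule simulatesD(2)[OF hg(2)]) (simp add: that)
        then show ?thesis by (simp only: Suc)
      qed
      also have "\<dots> \<longleftrightarrow> (\<exists>s. r s ys (Suc n) = Suc y)"
      proof
        assume "\<exists>z. (\<exists>s. r s ys n = Suc z) \<and> (\<exists>t. hg (t # n # z # ys) = Suc y)"
        then obtain z s t where z: "r s ys n = Suc z" "hg (t # n # z # ys) = Suc y" by blast
        have "r (max s t) ys n = Suc z" by (rule mono[OF z(1) _ that]) simp
        moreover have "hg (max s t # n # z # ys) = Suc y"
          by (rule simulatesD(1)[OF hg(2) _ z(2)]) (simp_all add: that)
        ultimately show "\<exists>s. r s ys (Suc n) = Suc y" unfolding r_Suc by blast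
      qed (unfold r_Suc, blast)
      finally show ?case .
    qed
    have "simulates k (Prim f g) h"
      unfolding simulates_def h_def
    proof (intro conjI allI impI)
      fix xs :: "nat list" and s t y :: nat
      assume "length xs = k" and st: "s \<le> t"
        and r: "r (hd (s # xs)) (tl (tl (s # xs))) (hd (tl (s # xs))) = Suc y"
      then have ys: "length (tl xs) = m" using Suc by simp
      have "r s (tl xs) (hd xs) = Suc y" using r by simp
      then show "r (hd (t # xs)) (tl (tl (t # xs))) (hd (tl (t # xs))) = Suc y"
        using mono[OF _ st ys] by simp
    next
      fix xs :: "nat list" and y :: nat
      assume "length xs = k"
      then obtain x ys where xs: "xs = x # ys" "length ys = m" unfolding Suc length_Suc_conv by blast
      show "ev noorc (Prim f g) xs y \<longleftrightarrow> (\<exists>s. r (hd (s # xs)) (tl (tl (s # xs))) (hd (tl (s # xs))) = Suc y)"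
        unfolding xs(1) using r_ev[OF xs(2), of x y] by simp
    qed
    ultimately show ?thesis by blast
  qed
next
  case (Mn f)
  obtain hf where hf: "computable (Suc (Suc k)) hf" "simulates (Suc k) f hf" using Mn by blast
  \<comment> \<open>Outputs are shifted by one: 1 reports the output 0 that ends the search, values
    above 1 report positive outputs, and 0 reports a computation that is still running and blocks
    the search.\<close>
  define Q where "Q s xs n \<longleftrightarrow> hf (s # n # xs) = 1 \<and> (\<forall>m<n. 1 < hf (s # m # xs))" for s xs n
  \<comment> \<open>At most one \<open>n\<close> satisfies \<open>Q\<close>, so the sum has at most
    one nonzero term and selects it.\<close>
  define h where "h = (\<lambda>zs. \<Sum>n<hd zs. if Q (hd zs) (tl zs) n then Suc n else 0)"
  have "computable (Suc k) h"
    unfolding h_def Q_def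
    by (rule computable_sum computable_if decidable_conj decidable_all decidable_eq decidable_less
      computable_Suc computable_const computable_subst[OF hf(1)] tuple_intros | simp)+
  have h: "h (s # xs) = Suc y \<longleftrightarrow> y < s \<and> Q s xs y" for s xs y
  proof (cases "\<exists>n<s. Q s xs n")
    case True
    then obtain n where n: "n < s" "Q s xs n" by blast
    have *: "Q s xs n' \<longleftrightarrow> n' = n" for n'
      using n(2) by (cases n n' rule: linorder_cases) (auto simp: Q_def)
    then show ?thesis using n by (auto simp: h_def)
  next
    case False
    then have "h (s # xs) = 0" by (auto simp: h_def)
    then show ?thesis using False by auto
  qed
  have mono: "Q t xs n" if "Q s xs n" "s \<le> t" "length xs = k" for s t xs n
  proof -
    have *: "1 < hf (t # m # xs)" if m: "1 < hf (s # m # xs)" for m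
      using simulatesD(1)[OF hf(2), of "m # xs" s "hf (s # m # xs) - 1" t] m \<open>s \<le> t\<close> \<open>length xs = k\<close> by simp
    show ?thesis
      using that * simulatesD(1)[OF hf(2), of "n # xs" s 0 t] unfolding Q_def by simp
  qed
  have "ev noorc (Mn f) xs n \<longleftrightarrow> (\<exists>s. n < s \<and> Q s xs n)" if xs: "length xs = k" for xs n
  proof
    assume "ev noorc (Mn f) xs n"
    then have 0: "ev noorc f (n # xs) 0" and pos: "\<And>m. m < n \<Longrightarrow> \<exists>y. ev noorc f (m # xs) (Suc y)"
      by (auto elim: ev_MnE)
    obtain s where s: "hf (s # n # xs) = Suc 0" using 0 simulatesD(2)[OF hf(2)] xs by auto
    have "\<exists>t. \<forall>m<n. 1 < hf (t # m # xs)"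
    proof (rule bounded_mono_ex)
      fix m assume "m < n"
      then obtain y where "ev noorc f (m # xs) (Suc y)" using pos by blast
      then obtain t where "hf (t # m # xs) = Suc (Suc y)" using simulatesD(2)[OF hf(2)] xs by auto
      then show "\<exists>t. 1 < hf (t # m # xs)" by (intro exI[of _ t]) simp
    next
      fix m s t assume "1 < hf (s # m # xs)" "s \<le> t"
      then show "1 < hf (t # m # xs)"
        using simulatesD(1)[OF hf(2), of "m # xs" s "hf (s # m # xs) - 1" t] xs by simp
    qed
    then obtain t where t: "\<And>m. m < n \<Longrightarrow> 1 < hf (t # m # xs)" by blast
    \<comment> \<open>\<open>Suc n\<close> takes part because \<open>h\<close> only tries candidates
      below the stage.\<close>
    define u where "u = max (max s t) (Suc n)"
    have "hf (u # n # xs) = 1" using simulatesD(1)[OF hf(2) _ s, of u] xs by (simp add: u_def)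
    moreover have "1 < hf (u # m # xs)" if "m < n" for m
      using simulatesD(1)[OF hf(2), of "m # xs" t "hf (t # m # xs) - 1" u] xs t[OF that] by (simp add: u_def)
    ultimately have "n < u \<and> Q u xs n" by (auto simp: Q_def u_def)
    then show "\<exists>s. n < s \<and> Q s xs n" by blast
  next
    assume "\<exists>s. n < s \<and> Q s xs n"
    then obtain s where s: "hf (s # n # xs) = 1" "\<And>m. m < n \<Longrightarrow> 1 < hf (s # m # xs)"
      by (auto simp: Q_def)
    have "\<exists>y. ev noorc f (m # xs) (Suc y)" if "m < n" for m
    proof -
      from s(2)[OF that] obtain y where "hf (s # m # xs) = Suc (Suc y)" using less_iff_Suc_add by auto
      then show ?thesis using simulatesD(2)[OF hf(2), of "m # xs"] xs by auto
    qed
    then show "ev noorc (Mn f) xs n"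
      using s(1) simulatesD(2)[OF hf(2)] xs by (intro ev_Mn) auto
  qed
  moreover have "t > y \<and> Q t xs y" if "length xs = k" "s \<le> t" "s > y \<and> Q s xs y" for xs s t y
    using mono[OF _ that(2,1)] that(2,3) by simp
  ultimately have "simulates k (Mn f) h"
    unfolding simulates_def h by blast
  then show ?case using \<open>computable (Suc k) h\<close> by blast
qed

section \<open>Computing with binary strings\<close>

definition decode :: "nat \<Rightarrow> bool list" where "decode = inv code"

lemma inj_code: "inj code"
proof (rule injI)
  fix \<sigma> \<tau> assume "code \<sigma> = code \<tau>"
  then show "\<sigma> = \<tau>"
  proof (induction \<sigma> arbitrary: \<tau>)
    case Nil
    then show ?case by (cases \<tau>) auto
  next
    case (Cons b \<sigma>)
    then obtain c \<rho> where \<tau>: "\<tau> = c # \<rho>" by (cases \<tau>) auto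
    with Cons(2) have "2 * code \<sigma> + (if b then 1 else 0) = 2 * code \<rho> + (if c then 1 else 0)"
      by simp
    then have "b = c \<and> code \<sigma> = code \<rho>" by (auto split: if_splits; presburger)
    then show ?case using Cons(1) \<tau> by blast
  qed
qed

text \<open>The coding is bijective base two with digits 1 and 2, least significant first: the first
  bit of a nonzero code is \<open>True\<close> exactly if the code is even, and
  \<open>(x - 1) div 2\<close> codes the rest.\<close>

lemma surj_code: "\<exists>\<sigma>. code \<sigma> = x"
proof (induction x rule: less_induct)
  case (less x)
  show ?case
  proof (cases "x = 0")
    case True
    then show ?thesis by (metis code.simps(1))
  next
    case False
    then obtain \<sigma> where \<sigma>: "code \<sigma> = (x - 1) div 2" using less[of "(x - 1) div 2"] by fastforce
    have "code ((x mod 2 = 0) # \<sigma>) = x" using \<sigma> False by (simp; presburger)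
    then show ?thesis by blast
  qed
qed

lemma decode_code [simp]: "decode (code \<sigma>) = \<sigma>"
  by (simp add: decode_def inj_code)

lemma code_decode [simp]: "code (decode x) = x"
  using surj_code[of x] by (metis decode_code)

lemma code_append: "code (\<sigma> @ \<tau>) = code \<sigma> + 2 ^ length \<sigma> * code \<tau>"
  by (induction \<sigma>) (auto simp: algebra_simps)

lemma code_bounds: "2 ^ length \<sigma> \<le> Suc (code \<sigma>)" "Suc (code \<sigma>) < 2 ^ Suc (length \<sigma>)"
  by (induction \<sigma>) auto

text \<open>Bounds the search for prefixes of a string, and makes the code of a string usable as a
  stage that increases along a sequence.\<close>

lemma code_prefix_le: "prefix \<sigma> \<tau> \<Longrightarrow> code \<sigma> \<le> code \<tau>"
  by (auto simp: prefix_def code_append)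

text \<open>A code \<open>x\<close> of a string of length \<open>n\<close> satisfies
  \<open>2 ^ n \<le> x + 1 < 2 ^ (n + 1)\<close>, so the sum counts the \<open>k\<close> below the
  length. This makes the length computable from the code.\<close>

lemma length_decode: "length (decode x) = (\<Sum>k<x. if 2 ^ Suc k \<le> Suc x then 1 else 0)"
proof -
  define \<sigma> where "\<sigma> = decode x"
  have x: "x = code \<sigma>" by (simp add: \<sigma>_def)
  have *: "2 ^ Suc k \<le> Suc x \<longleftrightarrow> k < length \<sigma>" for k
  proof
    assume "2 ^ Suc k \<le> Suc x"
    then have "(2::nat) ^ Suc k < 2 ^ Suc (length \<sigma>)" using code_bounds(2)[of \<sigma>] x by linarith
    then show "k < length \<sigma>" by (subst (asm) power_strict_increasing_iff) auto
  next
    assume "k < length \<sigma>"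
    then have "(2::nat) ^ Suc k \<le> 2 ^ length \<sigma>" by (intro power_increasing) auto
    then show "2 ^ Suc k \<le> Suc x" using code_bounds(1)[of \<sigma>] x by linarith
  qed
  have "length \<sigma> < 2 ^ length \<sigma>" by (rule less_exp)
  then have "length \<sigma> \<le> x" using code_bounds(1)[of \<sigma>] x by linarith
  then have "{k. k < x \<and> k < length \<sigma>} = {..<length \<sigma>}" by auto
  then show ?thesis unfolding * \<sigma>_def[symmetric] by (simp add: sum.If_cases Int_def)
qed

text \<open>String-valued functions are computed on codes; this rule lets a numeric variable
  \<open>z\<close> stand for the string \<open>decode z\<close>.\<close>

lemma computable_code_decode: "computable k f \<Longrightarrow> computable k (\<lambda>xs. code (decode (f xs)))"
  by simp

lemma computable_length:
  assumes "computable k (\<lambda>xs. code (F xs))"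
  shows "computable k (\<lambda>xs. length (F xs))"
proof -
  have "computable (Suc 0) (\<lambda>xs. \<Sum>k<xs ! 0. if 2 ^ Suc k \<le> Suc (xs ! 0) then 1 else 0)"
    by (rule computable_intros | simp)+
  from computable_comp1[OF this[folded length_decode] assms] show ?thesis by simp
qed

lemma computable_append:
  assumes "computable k (\<lambda>xs. code (F xs))" "computable k (\<lambda>xs. code (G xs))"
  shows "computable k (\<lambda>xs. code (F xs @ G xs))"
  unfolding code_append by (rule computable_intros computable_length assms)+

text \<open>By \<open>code_append\<close> the number \<open>w\<close> codes the remaining bits, and
  every number is such a code. The bound on \<open>w\<close> makes the relation decidable.\<close>

lemma prefix_code_iff:
  "prefix \<sigma> \<tau> \<longleftrightarrow> (\<exists>w<Suc (code \<tau>). code \<tau> = code \<sigma> + 2 ^ length \<sigma> * w)"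
proof
  assume "prefix \<sigma> \<tau>"
  then obtain \<rho> where \<rho>: "\<tau> = \<sigma> @ \<rho>" by (auto simp: prefix_def)
  have "code \<rho> \<le> 2 ^ length \<sigma> * code \<rho>" by simp
  also have "\<dots> \<le> code \<tau>" by (simp add: \<rho> code_append)
  finally show "\<exists>w<Suc (code \<tau>). code \<tau> = code \<sigma> + 2 ^ length \<sigma> * w"
    by (intro exI[of _ "code \<rho>"]) (auto simp: \<rho> code_append)
next
  assume "\<exists>w<Suc (code \<tau>). code \<tau> = code \<sigma> + 2 ^ length \<sigma> * w"
  then obtain w where "code \<tau> = code \<sigma> + 2 ^ length \<sigma> * w" by blast
  then have "code \<tau> = code (\<sigma> @ decode w)" by (simp add: code_append)
  then show "prefix \<sigma> \<tau>" using inj_code by (auto dest: injD)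
qed

lemma computable_weaken_code: "computable k (\<lambda>xs. code (F xs)) \<Longrightarrow> computable (Suc k) (\<lambda>zs. code (F (tl zs)))"
  by (rule computable_weaken)

lemma decidable_prefix:
  assumes "computable k (\<lambda>xs. code (F xs))" "computable k (\<lambda>xs. code (G xs))"
  shows "decidable k (\<lambda>xs. prefix (F xs) (G xs))"
  unfolding prefix_code_iff
  by (rule computable_intros computable_length computable_weaken_code assms)+

lemma decidable_all_prefix:
  assumes "computable k (\<lambda>xs. code (F xs))" "decidable (Suc k) (\<lambda>zs. P (tl zs) (decode (hd zs)))"
  shows "decidable k (\<lambda>xs. \<forall>\<sigma>. prefix \<sigma> (F xs) \<longrightarrow> P xs \<sigma>)"
proof -
  have "decidable k (\<lambda>xs. \<forall>z<Suc (code (F xs)). prefix (decode z) (F xs) \<longrightarrow> P xs (decode z))"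
    by (rule computable_intros decidable_prefix computable_weaken_code computable_code_decode assms)+
  moreover have "(\<forall>z<Suc (code \<tau>). prefix (decode z) \<tau> \<longrightarrow> Q (decode z)) \<longleftrightarrow> (\<forall>\<sigma>. prefix \<sigma> \<tau> \<longrightarrow> Q \<sigma>)" for \<tau> Q
    by (metis code_prefix_le decode_code less_Suc_eq_le)
  ultimately show ?thesis by simp
qed

lemma code_less_power: "length \<sigma> \<le> n \<Longrightarrow> code \<sigma> < 2 ^ Suc n"
proof -
  assume "length \<sigma> \<le> n"
  then have "(2::nat) ^ Suc (length \<sigma>) \<le> 2 ^ Suc n" by (intro power_increasing) auto
  then show ?thesis using code_bounds(2)[of \<sigma>] by linarith
qed

lemma decidable_all_length:
  assumes "computable k b" "decidable (Suc k) (\<lambda>zs. P (tl zs) (decode (hd zs)))"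
  shows "decidable k (\<lambda>xs. \<forall>\<sigma>. length \<sigma> = b xs \<longrightarrow> P xs \<sigma>)"
proof -
  have "decidable k (\<lambda>xs. \<forall>z<2 ^ Suc (b xs). length (decode z) = b xs \<longrightarrow> P xs (decode z))"
    by (rule computable_intros computable_length computable_weaken computable_code_decode assms)+
  moreover have "(\<forall>z<2 ^ Suc n. length (decode z) = n \<longrightarrow> Q (decode z)) \<longleftrightarrow> (\<forall>\<sigma>. length \<sigma> = n \<longrightarrow> Q \<sigma>)" for n Q
    by (metis code_less_power decode_code order_refl)
  ultimately show ?thesis by simp
qed

text \<open>This is how measures of clopen sets become computable: the count at level
  \<open>n\<close>, divided by \<open>2 ^ n\<close>, is the measure.\<close>

lemma computable_card_length:
  assumes "computable k b" "decidable (Suc k) (\<lambda>zs. P (tl zs) (decode (hd zs)))"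
  shows "computable k (\<lambda>xs. card {\<sigma>. length \<sigma> = b xs \<and> P xs \<sigma>})"
proof -
  have "computable k (\<lambda>xs. \<Sum>z<2 ^ Suc (b xs). if length (decode z) = b xs \<and> P xs (decode z) then 1 else 0)"
    by (rule computable_intros computable_length computable_weaken computable_code_decode assms)+
  moreover have "(\<Sum>z<2 ^ Suc n. if length (decode z) = n \<and> Q (decode z) then 1 else 0) = card {\<sigma>. length \<sigma> = n \<and> Q \<sigma>}" for n Q
  proof -
    have "{z. z < 2 ^ Suc n \<and> length (decode z) = n \<and> Q (decode z)} = code ` {\<sigma>. length \<sigma> = n \<and> Q \<sigma>}"
      using code_less_power by (auto simp: image_iff) (metis code_decode)
    then show ?thesis
      using card_image[OF inj_on_subset[OF inj_code subset_UNIV], of "{\<sigma>. length \<sigma> = n \<and> Q \<sigma>}"] by (simp add: sum.If_cases Int_def)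
  qed
  ultimately show ?thesis by (simp only:)
qed

lemmas [computable_intros] = computable_code_decode computable_length computable_append decidable_prefix
  decidable_all_prefix decidable_all_length computable_card_length

text \<open>Simulating the enumerating program yields increasing decidable approximations to
  \<open>W\<close>. Decidability is stated for arbitrary computable arguments so that it can act as
  a closure rule.\<close>

lemma ce_pairs_stages:
  assumes "ce_pairs W"
  obtains R where "\<And>k f g H. computable k f \<Longrightarrow> computable k g \<Longrightarrow> computable k (\<lambda>xs. code (H xs))
      \<Longrightarrow> decidable k (\<lambda>xs. R (f xs) (g xs) (H xs))"
    "\<And>i s t \<sigma>. R s i \<sigma> \<Longrightarrow> s \<le> t \<Longrightarrow> R t i \<sigma>"
    "\<And>i \<sigma>. (i, \<sigma>) \<in> W \<longleftrightarrow> (\<exists>s. R s i \<sigma>)"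
proof -
  obtain c where c: "\<And>i \<sigma>. (i, \<sigma>) \<in> W \<longleftrightarrow> (\<exists>y. ev noorc c [i, code \<sigma>] y)"
    using assms by (auto simp: ce_pairs_def)
  obtain h where h: "computable (Suc (Suc (Suc 0))) h" "simulates (Suc (Suc 0)) c h"
    using ex_simulation by blast
  define R where "R s i \<sigma> \<longleftrightarrow> 0 < h [s, i, code \<sigma>]" for s i \<sigma>
  show thesis
  proof (rule that[of R])
    fix k f g and H :: "nat list \<Rightarrow> bool list"
    assume *: "computable k f" "computable k g" "computable k (\<lambda>xs. code (H xs))"
    have nil: "computable_tuple k 0 (\<lambda>_. [])" by (simp add: computable_tuple_def)
    show "decidable k (\<lambda>xs. R (f xs) (g xs) (H xs))"
      unfolding R_def by (rule computable_intros computable_subst[OF h(1)] * nil)+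
  next
    fix i s t \<sigma> assume "R s i \<sigma>" "s \<le> t"
    then show "R t i \<sigma>"
      using simulatesD(1)[OF h(2), of "[i, code \<sigma>]" s "h [s, i, code \<sigma>] - 1" t] by (simp add: R_def)
  next
    fix i \<sigma>
    have "(i, \<sigma>) \<in> W \<longleftrightarrow> (\<exists>y s. h [s, i, code \<sigma>] = Suc y)"
      unfolding c by (intro ex_cong1 simulatesD(2)[OF h(2)]) simp
    then show "(i, \<sigma>) \<in> W \<longleftrightarrow> (\<exists>s. R s i \<sigma>)"
      unfolding R_def gr0_conv_Suc by blast
  qed
qed

lemma ev_deterministic: "ev X c xs y \<Longrightarrow> ev X c xs z \<Longrightarrow> y = z"
proof (induction arbitrary: z rule: ev.induct)
  case (ev_Comp ys gs xs f y)
  from ev_Comp.prems obtain ys' where ys': "length ys' = length gs"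
    "\<forall>j<length gs. ev X (gs ! j) xs (ys' ! j)" "ev X f ys' z" by (rule ev_CompE)
  have "ys' = ys" using ys' ev_Comp.IH(1) ev_Comp.hyps(1) by (intro nth_equalityI) (simp, metis)
  then show ?case using ev_Comp.IH(2) ys'(3) by blast
next
  case (ev_Prim0 f xs y g)
  from ev_Prim0.prems have "ev X f xs z" by (rule ev_Prim0E)
  then show ?case by (rule ev_Prim0.IH)
next
  case (ev_PrimS f g n xs r y)
  from ev_PrimS.prems obtain r' where r': "ev X (Prim f g) (n # xs) r'" "ev X g (n # r' # xs) z"
    by (rule ev_PrimSE)
  then show ?case using ev_PrimS.IH by blast
next
  case (ev_Mn f n xs)
  from ev_Mn.prems have z: "ev X f (z # xs) 0" "\<forall>m<z. \<exists>y. ev X f (m # xs) (Suc y)"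
    by (blast elim: ev_MnE)+
  have "\<not> z < n" using ev_Mn.IH(2) z(1) by (metis nat.distinct(1))
  moreover have "\<not> n < z" using ev_Mn.IH(1) z(2) by (metis nat.distinct(1))
  ultimately show ?case by simp
qed (auto elim: ev_ZE ev_SE ev_ProjE ev_OrcE)

text \<open>\<open>Mn\<close> searches for the least witness. It looks for a zero, hence it is
  applied to the characteristic function of the negation.\<close>

lemma ce_pairs_ex:
  assumes "decidable (Suc (Suc (Suc 0))) (\<lambda>zs. P (zs ! 0) (zs ! 1) (decode (zs ! 2)))"
  shows "ce_pairs {(i, \<sigma>). \<exists>s. P s i \<sigma>}"
proof -
  obtain c where c: "\<And>zs. length zs = 3 \<Longrightarrow>
      ev noorc c zs (if \<not> P (zs ! 0) (zs ! 1) (decode (zs ! 2)) then 1 else 0)"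
    using decidable_not[OF assms] by (auto simp: decidable_def computable_def numeral_3_eq_3)
  have c': "ev noorc c [s, i, code \<sigma>] (if \<not> P s i \<sigma> then 1 else 0)" for s i \<sigma>
    using c[of "[s, i, code \<sigma>]"] by simp
  have "(\<exists>s. P s i \<sigma>) \<longleftrightarrow> (\<exists>y. ev noorc (Mn c) [i, code \<sigma>] y)" for i \<sigma>
  proof
    assume ex: "\<exists>s. P s i \<sigma>"
    define n where "n = (LEAST s. P s i \<sigma>)"
    have "P n i \<sigma>" using ex unfolding n_def by (rule LeastI_ex)
    moreover have "\<not> P m i \<sigma>" if "m < n" for m using that not_less_Least unfolding n_def by blast
    ultimately have "ev noorc (Mn c) [i, code \<sigma>] n"
      using c'[of _ i \<sigma>] by (intro ev_Mn) (metis One_nat_def)+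
    then show "\<exists>y. ev noorc (Mn c) [i, code \<sigma>] y" by blast
  next
    assume "\<exists>y. ev noorc (Mn c) [i, code \<sigma>] y"
    then obtain y where "ev noorc c [y, i, code \<sigma>] 0" by (auto elim: ev_MnE)
    from ev_deterministic[OF c' this] have "P y i \<sigma>" by (auto split: if_splits)
    then show "\<exists>s. P s i \<sigma>" by blast
  qed
  then show ?thesis unfolding ce_pairs_def by auto
qed

section \<open>Cantor space and effectively null trees\<close>

definition seg :: "(nat \<Rightarrow> bool) \<Rightarrow> nat \<Rightarrow> bool list" where
  "seg X n = map X [0..<n]"

lemma length_seg [simp]: "length (seg X n) = n"
  by (simp add: seg_def)

lemma seg_Suc: "seg X (Suc n) = seg X n @ [X n]"
  by (simp add: seg_def)

lemma mem_cyl_iff: "X \<in> cyl \<sigma> \<longleftrightarrow> seg X (length \<sigma>) = \<sigma>"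
proof
  show "seg X (length \<sigma>) = \<sigma>" if "X \<in> cyl \<sigma>"
    using that by (intro nth_equalityI) (simp_all add: cyl_def seg_def)
  show "X \<in> cyl \<sigma>" if "seg X (length \<sigma>) = \<sigma>"
  proof -
    have "X k = \<sigma> ! k" if "k < length \<sigma>" for k
      using arg_cong[OF \<open>seg X (length \<sigma>) = \<sigma>\<close>, of "\<lambda>\<tau>. \<tau> ! k"] that by (simp add: seg_def)
    then show ?thesis by (simp add: cyl_def)
  qed
qed

lemma seg_mem_cyl: "X \<in> cyl (seg X n)"
  by (simp add: mem_cyl_iff)

lemma take_seg: "take m (seg X n) = seg X (min m n)"
  by (simp add: seg_def take_map min_def)

lemma prefix_seg_iff: "prefix \<sigma> (seg X n) \<longleftrightarrow> length \<sigma> \<le> n \<and> X \<in> cyl \<sigma>"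
proof
  assume "prefix \<sigma> (seg X n)"
  then have "length \<sigma> \<le> n" "\<sigma> = take (length \<sigma>) (seg X n)"
    using prefix_length_le[of \<sigma> "seg X n"] by (auto simp: prefix_def)
  then show "length \<sigma> \<le> n \<and> X \<in> cyl \<sigma>" by (simp add: mem_cyl_iff take_seg)
next
  assume "length \<sigma> \<le> n \<and> X \<in> cyl \<sigma>"
  then have "\<sigma> = take (length \<sigma>) (seg X n)" by (simp add: mem_cyl_iff take_seg)
  then show "prefix \<sigma> (seg X n)" by (metis take_is_prefix)
qed

lemma cyl_antimono: "prefix \<sigma> \<tau> \<Longrightarrow> cyl \<tau> \<subseteq> cyl \<sigma>"
  by (auto simp: cyl_def prefix_def nth_append)

lemma mem_cyl_append: "(\<lambda>n. (\<sigma> @ \<tau>) ! n) \<in> cyl \<sigma>"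
  by (simp add: cyl_def nth_append)

lemma cyl_nonempty: "cyl \<sigma> \<noteq> {}"
  using mem_cyl_append[of \<sigma> "[]"] by blast

lemma open_bool_singleton: "open {b :: bool}"
proof -
  have "{b} = (if b then {False<..} else {..<True})" by auto
  then show ?thesis by simp
qed

lemma open_cyl: "open (cyl \<sigma>)"
  using product_topology_basis'[of "{..<length \<sigma>}" "\<lambda>k. {\<sigma> ! k}" id]
  by (simp add: cyl_def Ball_def open_bool_singleton)

text \<open>A basic open set of the product topology constrains finitely many coordinates, and a
  long enough segment of \<open>X\<close> fixes all of them.\<close>

lemma open_contains_cyl:
  assumes "open U" "X \<in> U"
  obtains n where "cyl (seg X n) \<subseteq> U"
proof -
  obtain B where B: "X \<in> (\<Pi>\<^sub>E i\<in>UNIV. B i)" "finite {i. B i \<noteq> UNIV}" "(\<Pi>\<^sub>E i\<in>UNIV. B i) \<subseteq> U"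
    using product_topology_open_contains_basis[OF assms(1)[unfolded open_fun_def] assms(2)]
    by (auto simp: topspace_euclidean)
  obtain n where n: "\<And>i. i \<in> {i. B i \<noteq> UNIV} \<Longrightarrow> i < n"
    using B(2) by (metis finite_nat_set_iff_bounded)
  have "Y i \<in> B i" if "Y \<in> cyl (seg X n)" for Y i
  proof (cases "i < n")
    case True
    then have "Y i = X i" using that by (simp add: cyl_def seg_def)
    then show ?thesis using B(1) by (auto simp: PiE_iff)
  qed (use n in auto)
  then have "cyl (seg X n) \<subseteq> (\<Pi>\<^sub>E i\<in>UNIV. B i)" by (auto simp: PiE_iff)
  then have "cyl (seg X n) \<subseteq> U" using B(3) by (rule subset_trans)
  then show thesis by (rule that)
qed

section \<open>The uniform measure of cylinders and of levels\<close>

interpretation coins: product_prob_space "\<lambda>_::nat. measure_pmf (bernoulli_pmf (1/2))" UNIV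
  by unfold_locales

lemma space_lam [simp]: "space lam = UNIV"
  by (simp add: lam_def space_PiM)

interpretation lam: prob_space lam
  unfolding lam_def by (rule coins.prob_space_axioms)

lemma
  shows sets_cyl: "cyl \<sigma> \<in> sets lam"
    and measure_cyl: "measure lam (cyl \<sigma>) = 1 / 2 ^ length \<sigma>"
proof -
  let ?M = "\<lambda>_::nat. measure_pmf (bernoulli_pmf (1/2))"
  have emb: "cyl \<sigma> = prod_emb UNIV ?M {..<length \<sigma>} (Pi\<^sub>E {..<length \<sigma>} (\<lambda>k. {\<sigma> ! k}))"
    by (auto simp: cyl_def prod_emb_def space_PiM PiE_iff restrict_def extensional_def)
  show "cyl \<sigma> \<in> sets lam"
    unfolding emb lam_def by (rule sets_PiM_I) auto
  have half: "measure (bernoulli_pmf (1/2)) {b} = 1/2" for b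
    by (cases b) (simp_all add: measure_pmf_single)
  show "measure lam (cyl \<sigma>) = 1 / 2 ^ length \<sigma>"
    unfolding emb lam_def by (subst coins.measure_PiM_emb) (auto simp: half power_one_over)
qed

lemma finite_strings: "finite {\<sigma> :: bool list. length \<sigma> = n \<and> P \<sigma>}"
  by (rule finite_subset[OF _ finite_lists_length_eq[of "UNIV :: bool set" n]]) auto

lemma
  shows sets_seg: "{X. P (seg X n)} \<in> sets lam"
    and measure_seg: "measure lam {X. P (seg X n)} = card {\<sigma>. length \<sigma> = n \<and> P \<sigma>} / 2 ^ n"
proof -
  have eq: "{X. P (seg X n)} = (\<Union>\<sigma>\<in>{\<sigma>. length \<sigma> = n \<and> P \<sigma>}. cyl \<sigma>)"
    by (auto simp: mem_cyl_iff)
  show "{X. P (seg X n)} \<in> sets lam"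
    unfolding eq by (intro sets.finite_UN finite_strings sets_cyl)
  have "disjoint_family_on cyl {\<sigma>. length \<sigma> = n \<and> P \<sigma>}"
    by (auto simp: disjoint_family_on_def mem_cyl_iff)
  then have "measure lam {X. P (seg X n)} = (\<Sum>\<sigma>\<in>{\<sigma>. length \<sigma> = n \<and> P \<sigma>}. measure lam (cyl \<sigma>))"
    unfolding eq by (intro lam.finite_measure_finite_Union finite_strings) (auto simp: sets_cyl)
  then show "measure lam {X. P (seg X n)} = card {\<sigma>. length \<sigma> = n \<and> P \<sigma>} / 2 ^ n"
    by (simp add: measure_cyl)
qed

text \<open>Turns an inclusion of clopen sets into a bounded check: an extension of
  \<open>\<sigma>\<close> by \<open>s\<close> bits is long enough to show a prefix of length
  \<open>s\<close>.\<close>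

lemma cyl_subset_iff:
  "cyl \<sigma> \<subseteq> {X. P (seg X s)} \<longleftrightarrow>
    (\<forall>\<tau>. length \<tau> = length \<sigma> + s \<longrightarrow> prefix \<sigma> \<tau> \<longrightarrow> (\<forall>\<rho>. prefix \<rho> \<tau> \<longrightarrow> length \<rho> = s \<longrightarrow> P \<rho>))"
proof
  assume sub: "cyl \<sigma> \<subseteq> {X. P (seg X s)}"
  show "\<forall>\<tau>. length \<tau> = length \<sigma> + s \<longrightarrow> prefix \<sigma> \<tau> \<longrightarrow> (\<forall>\<rho>. prefix \<rho> \<tau> \<longrightarrow> length \<rho> = s \<longrightarrow> P \<rho>)"
  proof (intro allI impI)
    fix \<tau> \<rho> assume \<tau>: "prefix \<sigma> \<tau>" "prefix \<rho> \<tau>" "length \<rho> = s"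
    obtain X where "X \<in> cyl \<tau>" using cyl_nonempty by blast
    then have "X \<in> cyl \<sigma>" "X \<in> cyl \<rho>" using \<tau> cyl_antimono by blast+
    then have "P (seg X s)" "seg X s = \<rho>" using sub \<tau>(3) mem_cyl_iff[of X \<rho>] by blast+
    then show "P \<rho>" by simp
  qed
next
  assume *: "\<forall>\<tau>. length \<tau> = length \<sigma> + s \<longrightarrow> prefix \<sigma> \<tau> \<longrightarrow> (\<forall>\<rho>. prefix \<rho> \<tau> \<longrightarrow> length \<rho> = s \<longrightarrow> P \<rho>)"
  show "cyl \<sigma> \<subseteq> {X. P (seg X s)}"
  proof
    fix X assume "X \<in> cyl \<sigma>"
    then show "X \<in> {X. P (seg X s)}"
      using *[rule_format, of "seg X (length \<sigma> + s)" "seg X s"] by (simp add: prefix_seg_iff seg_mem_cyl)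
  qed
qed

text \<open>The inequality says that level \<open>s\<close> has measure at most
  \<open>1 / 2 ^ i\<close>. It is decidable, and so is the inclusion by
  \<open>cyl_subset_iff\<close>; only the search for \<open>s\<close> is unbounded.\<close>

lemma ce_pairs_cyl_subset_seg:
  assumes T: "\<And>k F. computable k (\<lambda>xs. code (F xs)) \<Longrightarrow> decidable k (\<lambda>xs. F xs \<in> T)"
  shows "ce_pairs {(i, \<sigma>). \<exists>s. 2 ^ i * card {\<tau>. length \<tau> = s \<and> \<tau> \<in> T} \<le> 2 ^ s \<and> cyl \<sigma> \<subseteq> {X. seg X s \<in> T}}"
  unfolding cyl_subset_iff[of _ "\<lambda>\<tau>. \<tau> \<in> T"]
  by (rule ce_pairs_ex) (rule computable_intros T | simp)+

text \<open>The measure of a level of a computable tree can be computed, so a level of measure at most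
  \<open>2\<^sup>-\<^sup>i\<close> can be found effectively.\<close>
lemma null_tree_not_MLR:
  assumes T: "\<And>k F. computable k (\<lambda>xs. code (F xs)) \<Longrightarrow> decidable k (\<lambda>xs. F xs \<in> T)"
    and tree: "\<And>\<sigma> \<tau>. prefix \<sigma> \<tau> \<Longrightarrow> \<tau> \<in> T \<Longrightarrow> \<sigma> \<in> T"
    and null: "\<And>i. \<exists>s. 2 ^ i * card {\<tau>. length \<tau> = s \<and> \<tau> \<in> T} \<le> 2 ^ s"
    and X: "\<And>n. seg X n \<in> T"
  shows "X \<notin> MLR"
proof -
  define good where "good i s \<longleftrightarrow> 2 ^ i * card {\<tau>. length \<tau> = s \<and> \<tau> \<in> T} \<le> 2 ^ s" for i s :: nat
  define s where "s i = (LEAST s. good i s)" for i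
  define V where "V i = {X. seg X (s i) \<in> T}" for i
  have good_s: "good i (s i)" for i
    unfolding s_def using null[of i] unfolding good_def by (rule LeastI_ex)
  \<comment> \<open>The levels of a tree decrease, so the first good level contains all good
    levels.\<close>
  have mono: "{X. seg X t \<in> T} \<subseteq> V i" if "good i t" for i t
  proof
    fix X assume "X \<in> {X. seg X t \<in> T}"
    moreover have "s i \<le> t" unfolding s_def by (rule Least_le) fact
    then have "prefix (seg X (s i)) (seg X t)" by (simp add: prefix_seg_iff seg_mem_cyl)
    ultimately show "X \<in> V i" using tree by (auto simp: V_def)
  qed
  have "MLtest V"
    unfolding MLtest_def
  proof (intro conjI allI)
    fix i
    have "V i = (\<Union>\<sigma>\<in>{\<sigma>. length \<sigma> = s i \<and> \<sigma> \<in> T}. cyl \<sigma>)"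
      by (auto simp: V_def mem_cyl_iff)
    then show "open (V i)" using open_cyl by auto
    have "2 ^ i * real (card {\<tau>. length \<tau> = s i \<and> \<tau> \<in> T}) \<le> 2 ^ s i"
      using of_nat_mono[OF good_s[of i, unfolded good_def], where ?'a = real] by simp
    then have "measure lam (V i) \<le> (1/2) ^ i"
      unfolding V_def measure_seg[of "\<lambda>\<sigma>. \<sigma> \<in> T"] by (simp add: field_simps power_one_over)
    then show "emeasure lam (V i) \<le> ennreal ((1/2) ^ i)"
      unfolding lam.emeasure_eq_measure by (rule ennreal_leI)
  next
    have "cyl \<sigma> \<subseteq> V i \<longleftrightarrow> (\<exists>s. good i s \<and> cyl \<sigma> \<subseteq> {X. seg X s \<in> T})" for i \<sigma>
      using mono good_s unfolding V_def by blast
    then show "ce_pairs {(i, \<sigma>). cyl \<sigma> \<subseteq> V i}"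
      using ce_pairs_cyl_subset_seg[OF T] unfolding good_def by simp
  qed
  moreover have "X \<in> (\<Inter>i. V i)" using X by (simp add: V_def)
  ultimately show ?thesis unfolding MLR_def by blast
qed

text \<open>At most \<open>2 ^ m\<close> strings survive at level \<open>m + i\<close>, so the tree
  of such sequences is null. Used to find a member that is not random in any given cylinder.\<close>

lemma eventually_zero_not_MLR:
  assumes "\<And>k. m \<le> k \<Longrightarrow> \<not> X k"
  shows "X \<notin> MLR"
proof (rule null_tree_not_MLR)
  \<comment> \<open>A bit \<open>True\<close> at position \<open>length \<tau>\<close> is expressed
    by the prefix \<open>\<tau> @ [True]\<close>, so that membership is decidable by the closure
    rules.\<close>
  let ?T = "{\<sigma>. \<forall>\<tau>. prefix \<tau> \<sigma> \<longrightarrow> m \<le> length \<tau> \<longrightarrow> \<not> prefix (\<tau> @ [True]) \<sigma>}"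
  show "decidable k (\<lambda>xs. F xs \<in> ?T)" if *: "computable k (\<lambda>xs. code (F xs))" for k F
    unfolding mem_Collect_eq
    by (rule computable_intros * computable_weaken_code | simp)+
  show "\<sigma> \<in> ?T" if "prefix \<sigma> \<tau>" "\<tau> \<in> ?T" for \<sigma> \<tau>
    using that prefix_order.trans by blast
  show "seg X n \<in> ?T" for n
    using assms by (auto simp: prefix_seg_iff cyl_def)
  show "\<exists>s. 2 ^ i * card {\<tau>. length \<tau> = s \<and> \<tau> \<in> ?T} \<le> 2 ^ s" for i
  proof
    let ?A = "{\<tau>. length \<tau> = m + i \<and> \<tau> \<in> ?T}"
    have nth: "\<not> \<tau> ! k" if "\<tau> \<in> ?T" "m \<le> k" "k < length \<tau>" for \<tau> k
    proof
      assume "\<tau> ! k"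
      then have "prefix (take k \<tau> @ [True]) \<tau>"
        using take_Suc_conv_app_nth[OF that(3)] take_is_prefix[of "Suc k" \<tau>] by simp
      then show False using that by (auto simp: take_is_prefix)
    qed
    \<comment> \<open>All bits from position \<open>m\<close> on are \<open>False\<close>, so the
      first \<open>m\<close> bits determine the string.\<close>
    have "inj_on (take m) ?A"
    proof (rule inj_onI)
      fix \<sigma> \<tau> assume *: "\<sigma> \<in> ?A" "\<tau> \<in> ?A" "take m \<sigma> = take m \<tau>"
      show "\<sigma> = \<tau>"
      proof (rule nth_equalityI)
        fix k assume k: "k < length \<sigma>"
        show "\<sigma> ! k = \<tau> ! k"
        proof (cases "k < m")
          case True
          then show ?thesis using * by (metis nth_take)
        next
          case False
          then show ?thesis using nth[of \<sigma> k] nth[of \<tau> k] * k by auto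
        qed
      qed (use * in auto)
    qed
    moreover have "take m ` ?A \<subseteq> {\<sigma>. length \<sigma> = m \<and> True}" by auto
    ultimately have "card ?A \<le> card {\<sigma>::bool list. length \<sigma> = m \<and> True}"
      by (intro card_inj_on_le finite_strings)
    also have "\<dots> = 2 ^ m" using card_lists_length_eq[of "UNIV :: bool set" m] by simp
    finally show "2 ^ i * card ?A \<le> 2 ^ (m + i)" by (simp add: power_add)
  qed
qed

section \<open>Continuity of Turing functionals\<close>

text \<open>A halting computation asks finitely many oracle questions; the bounds of its
  subcomputations are combined by maxima.\<close>

lemma ev_use: "ev X c xs y \<Longrightarrow> \<exists>n. \<forall>Y. (\<forall>k<n. Y k = X k) \<longrightarrow> ev Y c xs y"
proof (induction rule: ev.induct)
  case (ev_Orc xs)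
  have "ev Y Orc xs (X (arg 0 xs))" if "\<forall>k<Suc (arg 0 xs). Y k = X k" for Y
    using ev.ev_Orc[of Y xs] that by simp
  then show ?case by blast
next
  case (ev_Comp ys gs xs f y)
  have "\<exists>n. \<forall>j<length gs. \<forall>Y. (\<forall>k<n. Y k = X k) \<longrightarrow> ev Y (gs ! j) xs (ys ! j)"
  proof (rule bounded_mono_ex)
    fix j assume "j < length gs"
    then show "\<exists>n. \<forall>Y. (\<forall>k<n. Y k = X k) \<longrightarrow> ev Y (gs ! j) xs (ys ! j)"
      using ev_Comp.IH(1) by blast
  qed (meson order_less_le_trans)
  then obtain n where n: "\<And>j Y. j < length gs \<Longrightarrow> \<forall>k<n. Y k = X k \<Longrightarrow> ev Y (gs ! j) xs (ys ! j)"
    by blast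
  obtain m where m: "\<And>Y. \<forall>k<m. Y k = X k \<Longrightarrow> ev Y f ys y" using ev_Comp.IH(2) by blast
  have "ev Y (Comp f gs) xs y" if "\<forall>k<max n m. Y k = X k" for Y
    using that n m ev_Comp.hyps(1) by (intro ev.ev_Comp[of ys]) auto
  then show ?case by blast
next
  case (ev_Prim0 f xs y g)
  then show ?case by (meson ev.ev_Prim0)
next
  case (ev_PrimS f g n xs r y)
  then obtain m1 m2 where m: "\<And>Y. \<forall>k<m1. Y k = X k \<Longrightarrow> ev Y (Prim f g) (n # xs) r"
    "\<And>Y. \<forall>k<m2. Y k = X k \<Longrightarrow> ev Y g (n # r # xs) y" by blast
  have "ev Y (Prim f g) (Suc n # xs) y" if "\<forall>k<max m1 m2. Y k = X k" for Y
    using that by (intro ev.ev_PrimS[OF m(1) m(2)]) auto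
  then show ?case by blast
next
  case (ev_Mn f n xs)
  have "\<exists>s. \<forall>m<n. \<forall>Y. (\<forall>k<s. Y k = X k) \<longrightarrow> (\<exists>y. ev Y f (m # xs) (Suc y))"
  proof (rule bounded_mono_ex)
    fix m assume "m < n"
    then show "\<exists>s. \<forall>Y. (\<forall>k<s. Y k = X k) \<longrightarrow> (\<exists>y. ev Y f (m # xs) (Suc y))"
      using ev_Mn.IH(2) by meson
  qed (meson order_less_le_trans)
  then obtain s where s: "\<And>m Y. m < n \<Longrightarrow> \<forall>k<s. Y k = X k \<Longrightarrow> \<exists>y. ev Y f (m # xs) (Suc y)"
    by blast
  obtain t where t: "\<And>Y. \<forall>k<t. Y k = X k \<Longrightarrow> ev Y f (n # xs) 0" using ev_Mn.IH(1) by blast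
  have "ev Y (Mn f) xs n" if "\<forall>k<max s t. Y k = X k" for Y
    using that s t by (intro ev.ev_Mn) auto
  then show ?case by blast
qed (blast intro: ev.intros)+

lemma TF_ev:
  assumes "TF c p = Some q" shows "ev p c [n] (q n)"
proof -
  obtain r where r: "\<forall>n. ev p c [n] (r n)"
    using assms unfolding TF_def by (auto split: if_splits)
  have "s = r" if "\<forall>n. ev p c [n] (s n)" for s
    using that r by (intro ext) (blast intro: ev_deterministic)
  then have "(THE q. \<forall>n. ev p c [n] (q n)) = r" using r by (intro the_equality) blast+
  then have "q = r" using assms unfolding TF_def by (auto split: if_splits)
  then show ?thesis using r by blast
qed

text \<open>The use principle for the first \<open>n\<close> output values with one common bound.
  Oracles near \<open>p\<close> are compared only where \<open>TF\<close> is defined, since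
  agreement with \<open>p\<close> on finitely many places cannot ensure that all computations
  halt.\<close>

lemma TF_continuous:
  assumes "TF c p = Some q"
  shows "\<exists>m. \<forall>j<n. \<forall>p' q'. (\<forall>k<m. p' k = p k) \<longrightarrow> TF c p' = Some q' \<longrightarrow> q' j = q j"
proof (rule bounded_mono_ex)
  fix j
  obtain m where "\<And>p'. \<forall>k<m. p' k = p k \<Longrightarrow> ev p' c [j] (q j)"
    using ev_use[OF TF_ev[OF assms]] by blast
  then show "\<exists>m. \<forall>p' q'. (\<forall>k<m. p' k = p k) \<longrightarrow> TF c p' = Some q' \<longrightarrow> q' j = q j"
    by (meson TF_ev ev_deterministic)
qed (meson order_less_le_trans)

lemma inj_chi_nat: "chi_nat m = chi_nat n \<Longrightarrow> m = n"
  by (metis chi_nat_def zero_neq_one)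

lemma delta_nat_eq_Some_iff: "delta_nat p = Some n \<longleftrightarrow> p = chi_nat n"
proof -
  have "(THE n. chi_nat m = chi_nat n) = m" for m
    by (rule the_equality) (auto dest: inj_chi_nat)
  then show ?thesis unfolding delta_nat_def by auto
qed

text \<open>Baire category in the closed set of paths through \<open>E\<close>, a tree without dead
  ends; \<open>D i\<close> generates a dense open set. The path meets \<open>D 0\<close>,
  \<open>D 1\<close>, ... in turn.\<close>

lemma baire_strings:
  fixes E :: "bool list \<Rightarrow> bool" and D :: "nat \<Rightarrow> bool list \<Rightarrow> bool"
  assumes "E \<sigma>"
    and prefix: "\<And>\<sigma> \<tau>. prefix \<sigma> \<tau> \<Longrightarrow> E \<tau> \<Longrightarrow> E \<sigma>"
    and extend: "\<And>\<tau>. E \<tau> \<Longrightarrow> \<exists>b. E (\<tau> @ [b])"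
    and dense: "\<And>i \<tau>. E \<tau> \<Longrightarrow> \<exists>\<tau>'. prefix \<tau> \<tau>' \<and> E \<tau>' \<and> D i \<tau>'"
  obtains X where "X \<in> cyl \<sigma>" "\<And>n. E (seg X n)" "\<And>i. \<exists>n. D i (seg X n)"
proof -
  \<comment> \<open>Only some prefix of \<open>f (Suc n)\<close> is required to satisfy
    \<open>D n\<close>: one more bit is added to make the lengths grow, and \<open>D n\<close> may
    fail after it.\<close>
  have "\<exists>f. \<forall>n. (E (f n) \<and> prefix \<sigma> (f n)) \<and>
    (prefix (f n) (f (Suc n)) \<and> length (f n) < length (f (Suc n)) \<and> (\<exists>\<rho>. prefix \<rho> (f (Suc n)) \<and> D n \<rho>))"
  proof (rule dependent_nat_choice)
    show "\<exists>\<tau>. E \<tau> \<and> prefix \<sigma> \<tau>" using assms(1) by blast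
    fix \<tau> n assume \<tau>: "E \<tau> \<and> prefix \<sigma> \<tau>"
    then obtain \<rho> where \<rho>: "prefix \<tau> \<rho>" "E \<rho>" "D n \<rho>" using dense by blast
    obtain b where b: "E (\<rho> @ [b])" using extend \<rho>(2) by blast
    show "\<exists>\<tau>'. (E \<tau>' \<and> prefix \<sigma> \<tau>') \<and> prefix \<tau> \<tau>' \<and> length \<tau> < length \<tau>' \<and> (\<exists>\<rho>. prefix \<rho> \<tau>' \<and> D n \<rho>)"
    proof (rule exI[of _ "\<rho> @ [b]"], intro conjI)
      show "prefix \<tau> (\<rho> @ [b])" using \<rho>(1) by (rule prefix_prefix)
      then show "prefix \<sigma> (\<rho> @ [b])" using \<tau> prefix_order.trans by blast
      show "length \<tau> < length (\<rho> @ [b])" using prefix_length_le[OF \<rho>(1)] by simp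
      show "\<exists>\<rho>'. prefix \<rho>' (\<rho> @ [b]) \<and> D n \<rho>'" using \<rho>(3) by (intro exI[of _ \<rho>]) simp
    qed (rule b)
  qed
  then obtain f where f: "\<And>n. E (f n)" "\<And>n. prefix \<sigma> (f n)" "\<And>n. prefix (f n) (f (Suc n))"
    "\<And>n. length (f n) < length (f (Suc n))" "\<And>n. \<exists>\<rho>. prefix \<rho> (f (Suc n)) \<and> D n \<rho>" by blast
  have mono: "prefix (f m) (f n)" if "m \<le> n" for m n
    using that
  proof (induction rule: dec_induct)
    case (step n)
    then show ?case using f(3) prefix_order.trans by blast
  qed simp
  have len: "n \<le> length (f n)" for n
  proof (induction n)
    case (Suc n)
    then show ?case using f(4)[of n] by linarith
  qed simp
  \<comment> \<open>\<open>f (Suc k)\<close> has length greater than \<open>k\<close>, so it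
    determines bit \<open>k\<close> of the limit.\<close>
  define X where "X k = f (Suc k) ! k" for k
  have X: "X \<in> cyl (f n)" for n
    unfolding cyl_def
  proof (intro CollectI allI impI)
    fix k assume k: "k < length (f n)"
    have k': "k < length (f (Suc k))" using len[of "Suc k"] by simp
    show "X k = f n ! k"
    proof (cases "n \<le> Suc k")
      case True
      then show ?thesis using mono[OF True] k by (auto simp: X_def prefix_def nth_append)
    next
      case False
      then have "prefix (f (Suc k)) (f n)" by (intro mono) simp
      then show ?thesis using k' by (auto simp: X_def prefix_def nth_append)
    qed
  qed
  show thesis
  proof (rule that)
    show "X \<in> cyl \<sigma>" using X[of 0] cyl_antimono[OF f(2)[of 0]] by blast
    have "prefix (seg X n) (f n)" for n
      using X[of n] len[of n] prefix_seg_iff[of "seg X n" X "length (f n)"]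
      by (simp add: mem_cyl_iff seg_mem_cyl)
    then show "E (seg X n)" for n using prefix f(1) by blast
    show "\<exists>n. D i (seg X n)" for i
    proof -
      obtain \<rho> where \<rho>: "prefix \<rho> (f (Suc i))" "D i \<rho>" using f(5) by blast
      have "X \<in> cyl \<rho>" using X cyl_antimono[OF \<rho>(1)] by blast
      then have "D i (seg X (length \<rho>))" using \<rho>(2) by (simp add: mem_cyl_iff)
      then show ?thesis by blast
    qed
  qed
qed

section \<open>Binary sequences as points of Baire space\<close>

definition nat_seq :: "(nat \<Rightarrow> bool) \<Rightarrow> nat \<Rightarrow> nat" where
  "nat_seq X n = (if X n then 1 else 0)"

lemma to_cantor_nat_seq [simp]: "to_cantor (nat_seq X) = X"
  by (auto simp: to_cantor_def nat_seq_def)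

lemma nat_seq_MLR_B: "nat_seq X \<in> MLR_B \<longleftrightarrow> X \<in> MLR"
  by (simp add: MLR_B_def) (simp add: nat_seq_def)

lemma nat_seq_agree: "seg Y n = seg X n \<Longrightarrow> \<forall>k<n. nat_seq Y k = nat_seq X k"
  by (simp add: seg_def nat_seq_def)

section \<open>The set that is not reducible\<close>

locale universal_test =
  fixes U assumes universal: "universal_MLtest U"
begin

definition "W = {\<sigma>. cyl \<sigma> \<subseteq> U 1}"

definition "K = - U 1"

text \<open>No segment of a member of \<open>K\<close> is in \<open>W\<close>, so a child in
  \<open>W\<close> is always the one that the sequence avoids.\<close>

definition "A = {X. \<exists>n. \<forall>k\<ge>n. \<forall>b. seg X k @ [b] \<notin> W}"

text \<open>By \<open>null_portion_empty\<close> these are exactly the strings with an extension in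
  \<open>K\<close>. Positive measure is the form in which they can be extended by additivity and
  reached by almost-everywhere arguments.\<close>

definition "E \<sigma> \<longleftrightarrow> 0 < measure lam (K \<inter> cyl \<sigma>)"

lemma test_U: "MLtest U"
  using universal by (simp add: universal_MLtest_def)

text \<open>A sequence that fails some test lies in every \<open>U i\<close> by universality, in
  particular in \<open>U 1\<close>.\<close>

lemma K_subset_MLR: "K \<subseteq> MLR"
  using universal unfolding K_def MLR_def universal_MLtest_def by blast

lemma W_prefix: "prefix \<sigma> \<tau> \<Longrightarrow> \<sigma> \<in> W \<Longrightarrow> \<tau> \<in> W"
  using cyl_antimono unfolding W_def by blast

lemma mem_K_iff: "X \<in> K \<longleftrightarrow> (\<forall>n. seg X n \<notin> W)"
proof -
  have "open (U 1)" using test_U by (simp add: MLtest_def)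
  then have "X \<in> U 1 \<longleftrightarrow> (\<exists>n. cyl (seg X n) \<subseteq> U 1)"
    using open_contains_cyl[of "U 1" X] seg_mem_cyl[of X] by (metis subsetD)
  then show ?thesis by (simp add: K_def W_def)
qed

lemma sets_K: "K \<in> sets lam"
proof -
  have "K = (\<Inter>n. {X. seg X n \<notin> W})" using mem_K_iff by blast
  then show ?thesis using sets_seg[of "\<lambda>\<sigma>. \<sigma> \<notin> W"] by simp
qed

lemma sets_K_cyl: "K \<inter> cyl \<sigma> \<in> sets lam"
  by (intro sets.Int sets_K sets_cyl)

text \<open>Here the index 1 in \<open>K\<close> matters: the test bound is then 1/2, which leaves
  measure at least 1/2 for \<open>K\<close>.\<close>

lemma E_Nil: "E []"
proof -
  have "emeasure lam (U 1) \<le> ennreal ((1/2) ^ 1)" using test_U unfolding MLtest_def by blast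
  then have "measure lam (U 1) \<le> 1/2"
    unfolding lam.emeasure_eq_measure by (subst (asm) ennreal_le_iff) auto
  moreover have "measure lam K = 1 - measure lam (U 1)"
    using lam.prob_compl[of "U 1"] sets.compl_sets[OF sets_K] by (simp add: K_def Compl_eq_Diff_UNIV double_diff)
  ultimately show ?thesis by (simp add: E_def cyl_def)
qed

lemma E_prefix: "prefix \<sigma> \<tau> \<Longrightarrow> E \<tau> \<Longrightarrow> E \<sigma>"
  unfolding E_def using cyl_antimono[of \<sigma> \<tau>]
  by (meson Int_mono lam.finite_measure_mono order_less_le_trans sets_K_cyl subset_refl)

lemma cyl_split: "cyl \<sigma> = cyl (\<sigma> @ [True]) \<union> cyl (\<sigma> @ [False])"
  by (auto simp: mem_cyl_iff seg_Suc)

lemma E_extend: "E \<sigma> \<Longrightarrow> \<exists>b. E (\<sigma> @ [b])"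
proof (rule ccontr)
  assume "E \<sigma>" "\<not> (\<exists>b. E (\<sigma> @ [b]))"
  then have "measure lam (K \<inter> cyl (\<sigma> @ [b])) = 0" for b
    using measure_nonneg[of lam] by (metis E_def less_eq_real_def)
  moreover have "K \<inter> cyl \<sigma> = (K \<inter> cyl (\<sigma> @ [True])) \<union> (K \<inter> cyl (\<sigma> @ [False]))"
    using cyl_split by blast
  ultimately have "measure lam (K \<inter> cyl \<sigma>) \<le> 0"
    using measure_Un_le[OF sets_K_cyl[of "\<sigma> @ [True]"] sets_K_cyl[of "\<sigma> @ [False]"]] by simp
  then show False using \<open>E \<sigma>\<close> by (simp add: E_def)
qed

lemma E_imp_notin_W: "E \<sigma> \<Longrightarrow> \<sigma> \<notin> W"
proof
  assume "E \<sigma>" "\<sigma> \<in> W"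
  then have "K \<inter> cyl \<sigma> = {}" by (auto simp: W_def K_def)
  then show False using \<open>E \<sigma>\<close> by (simp add: E_def)
qed

lemma W_stages:
  obtains R where "\<And>k f F. computable k f \<Longrightarrow> computable k (\<lambda>xs. code (F xs))
      \<Longrightarrow> decidable k (\<lambda>xs. R (f xs) (F xs))"
    "\<And>s t \<sigma>. R s \<sigma> \<Longrightarrow> s \<le> t \<Longrightarrow> R t \<sigma>" "\<And>\<sigma>. \<sigma> \<in> W \<longleftrightarrow> (\<exists>s. R s \<sigma>)"
proof -
  have "ce_pairs {(i, \<sigma>). cyl \<sigma> \<subseteq> U i}" using test_U by (simp add: MLtest_def)
  then obtain R where R: "\<And>k f g F. computable k f \<Longrightarrow> computable k g \<Longrightarrow> computable k (\<lambda>xs. code (F xs))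
      \<Longrightarrow> decidable k (\<lambda>xs. R (f xs) (g xs) (F xs))" "\<And>i s t \<sigma>. R s i \<sigma> \<Longrightarrow> s \<le> t \<Longrightarrow> R t i \<sigma>"
    "\<And>i \<sigma>. (i, \<sigma>) \<in> {(i, \<sigma>). cyl \<sigma> \<subseteq> U i} \<longleftrightarrow> (\<exists>s. R s i \<sigma>)"
    by (rule ce_pairs_stages) blast
  show thesis
  proof (rule that[of "\<lambda>s. R s 1"])
    show "\<sigma> \<in> W \<longleftrightarrow> (\<exists>s. R s 1 \<sigma>)" for \<sigma> using R(3)[of 1 \<sigma>] by (simp add: W_def)
  qed (use R computable_const in auto)
qed

lemma code_seg_ge: "n \<le> code (seg X n)"
proof -
  have "n < 2 ^ n" by (rule less_exp)
  then show ?thesis using code_bounds(1)[of "seg X n"] unfolding length_seg by linarith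
qed

text \<open>For each \<open>i\<close>, the sequences whose segments of length at least
  \<open>i\<close> have no child in \<open>W\<close> are the paths of a computable tree: a string is
  checked against the approximation to \<open>W\<close> at the stage given by its own code.\<close>

lemma Sigma02_A: "Sigma02 A"
proof -
  obtain R where R: "\<And>k f F. computable k f \<Longrightarrow> computable k (\<lambda>xs. code (F xs))
      \<Longrightarrow> decidable k (\<lambda>xs. R (f xs) (F xs))"
    "\<And>s t \<sigma>. R s \<sigma> \<Longrightarrow> s \<le> t \<Longrightarrow> R t \<sigma>" "\<And>\<sigma>. \<sigma> \<in> W \<longleftrightarrow> (\<exists>s. R s \<sigma>)"
    by (rule W_stages) blast
  define T where "T i = {\<sigma>. \<forall>\<tau>. prefix \<tau> \<sigma> \<longrightarrow> i \<le> length \<tau> \<longrightarrow>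
    \<not> R (code \<sigma>) (\<tau> @ [True]) \<and> \<not> R (code \<sigma>) (\<tau> @ [False])}" for i
  have tree: "\<sigma> \<in> T i" if "prefix \<sigma> \<tau>" "\<tau> \<in> T i" for \<sigma> \<tau> i
    using that R(2) code_prefix_le[OF that(1)] prefix_order.trans unfolding T_def by blast
  have "decidable (Suc (Suc 0)) (\<lambda>xs. decode (xs ! 1) \<in> T (xs ! 0))"
    unfolding T_def mem_Collect_eq by (rule computable_intros R(1) | simp)+
  then obtain c where "\<And>xs. length xs = Suc (Suc 0) \<Longrightarrow> ev noorc c xs (if decode (xs ! 1) \<in> T (xs ! 0) then 1 else 0)"
    unfolding decidable_def computable_def by blast
  from this[of "[i, code \<sigma>]" for i \<sigma>]
  have c: "ev noorc c [i, code \<sigma>] (if \<sigma> \<in> T i then 1 else 0)" for i \<sigma> by simp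
  have "X \<in> paths (T i) \<longleftrightarrow> (\<forall>k\<ge>i. \<forall>b. seg X k @ [b] \<notin> W)" for X i
  proof
    assume X: "X \<in> paths (T i)"
    show "\<forall>k\<ge>i. \<forall>b. seg X k @ [b] \<notin> W"
    proof (intro allI impI notI)
      fix k b assume "i \<le> k" "seg X k @ [b] \<in> W"
      then obtain s where s: "R s (seg X k @ [b])" using R(3) by blast
      \<comment> \<open>A segment of this length extends \<open>seg X k\<close>, and its code is
        past the stage at which the child appears in \<open>W\<close>.\<close>
      define n where "n = max s k"
      have "seg X n \<in> T i" using X by (simp add: paths_def seg_def)
      moreover have "prefix (seg X k) (seg X n)" by (simp add: prefix_seg_iff seg_mem_cyl n_def)
      ultimately have "\<not> R (code (seg X n)) (seg X k @ [b])"
        using \<open>i \<le> k\<close> by (cases b) (auto simp: T_def)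
      moreover have "s \<le> code (seg X n)" using code_seg_ge[of n X] by (simp add: n_def)
      ultimately show False using R(2) s by blast
    qed
  next
    assume *: "\<forall>k\<ge>i. \<forall>b. seg X k @ [b] \<notin> W"
    have "seg X n \<in> T i" for n
      using * R(3) by (auto simp: T_def prefix_seg_iff mem_cyl_iff)
    then show "X \<in> paths (T i)" by (simp add: paths_def seg_def)
  qed
  then have "A = (\<Union>i. paths (T i))" unfolding A_def by blast
  moreover have "is_tree (T i)" for i
    unfolding is_tree_def using tree by (metis prefixI)
  ultimately show ?thesis unfolding Sigma02_def using c by blast
qed

text \<open>The portion is the set of paths of a computable tree. If it is null, the measures of the
  levels tend to 0, so \<open>null_tree_not_MLR\<close> excludes random paths, while
  \<open>K\<close> has only random members.\<close>

lemma null_portion_empty: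
  assumes "measure lam (K \<inter> cyl \<rho>) = 0" shows "K \<inter> cyl \<rho> = {}"
proof -
  obtain R where R: "\<And>k f F. computable k f \<Longrightarrow> computable k (\<lambda>xs. code (F xs))
      \<Longrightarrow> decidable k (\<lambda>xs. R (f xs) (F xs))"
    "\<And>s t \<sigma>. R s \<sigma> \<Longrightarrow> s \<le> t \<Longrightarrow> R t \<sigma>" "\<And>\<sigma>. \<sigma> \<in> W \<longleftrightarrow> (\<exists>s. R s \<sigma>)"
    by (rule W_stages) blast
  \<comment> \<open>Strings shorter than \<open>\<rho>\<close> are not compared with it; the
    comparison at length \<open>length \<rho>\<close> already confines the paths to the
    cylinder.\<close>
  define T where "T = {\<sigma>. (length \<rho> \<le> length \<sigma> \<longrightarrow> prefix \<rho> \<sigma>) \<and> (\<forall>\<tau>. prefix \<tau> \<sigma> \<longrightarrow> \<not> R (code \<sigma>) \<tau>)}"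
  have dec: "decidable k (\<lambda>xs. F xs \<in> T)" if *: "computable k (\<lambda>xs. code (F xs))" for k F
    unfolding T_def mem_Collect_eq
    by (rule computable_intros R(1) * computable_weaken_code | simp)+
  have tree: "\<sigma> \<in> T" if "prefix \<sigma> \<tau>" "\<tau> \<in> T" for \<sigma> \<tau>
  proof -
    have "prefix \<rho> \<sigma>" if "length \<rho> \<le> length \<sigma>"
      using that \<open>\<tau> \<in> T\<close> prefix_length_le[OF \<open>prefix \<sigma> \<tau>\<close>]
      by (intro prefix_length_prefix[OF _ \<open>prefix \<sigma> \<tau>\<close>]) (auto simp: T_def)
    moreover have "\<not> R (code \<sigma>) \<upsilon>" if "prefix \<upsilon> \<sigma>" for \<upsilon>
      using \<open>\<tau> \<in> T\<close> R(2) code_prefix_le[OF \<open>prefix \<sigma> \<tau>\<close>] prefix_order.trans[OF that \<open>prefix \<sigma> \<tau>\<close>]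
      unfolding T_def by blast
    ultimately show ?thesis by (simp add: T_def)
  qed
  have paths: "X \<in> K \<inter> cyl \<rho> \<longleftrightarrow> (\<forall>n. seg X n \<in> T)" for X
  proof
    assume "X \<in> K \<inter> cyl \<rho>"
    then show "\<forall>n. seg X n \<in> T"
      unfolding T_def using R(3) mem_K_iff by (auto simp: prefix_seg_iff mem_cyl_iff) metis
  next
    assume T: "\<forall>n. seg X n \<in> T"
    then have "prefix \<rho> (seg X (length \<rho>))" unfolding T_def by (metis (mono_tags, lifting) length_seg mem_Collect_eq order_refl)
    then have "X \<in> cyl \<rho>" by (simp add: prefix_seg_iff)
    moreover have "seg X n \<notin> W" for n
    proof
      assume "seg X n \<in> W"
      then obtain s where s: "R s (seg X n)" using R(3) by blast
      define m where "m = max s n"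
      have "prefix (seg X n) (seg X m)" by (simp add: prefix_seg_iff seg_mem_cyl m_def)
      then have "\<not> R (code (seg X m)) (seg X n)" using T by (auto simp: T_def)
      moreover have "s \<le> code (seg X m)" using code_seg_ge[of m X] by (simp add: m_def)
      ultimately show False using R(2) s by blast
    qed
    ultimately show "X \<in> K \<inter> cyl \<rho>" by (simp add: mem_K_iff)
  qed
  have "(\<lambda>s. measure lam {X. seg X s \<in> T}) \<longlonglongrightarrow> measure lam (\<Inter>s. {X. seg X s \<in> T})"
  proof (rule lam.finite_Lim_measure_decseq)
    show "range (\<lambda>s. {X. seg X s \<in> T}) \<subseteq> sets lam" using sets_seg[of "\<lambda>\<sigma>. \<sigma> \<in> T"] by blast
    show "decseq (\<lambda>s. {X. seg X s \<in> T})"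
      by (rule decseq_SucI) (auto simp: seg_Suc intro: tree[OF prefixI[OF refl]])
  qed
  also have "(\<Inter>s. {X. seg X s \<in> T}) = K \<inter> cyl \<rho>" using paths by blast
  finally have lim: "(\<lambda>s. measure lam {X. seg X s \<in> T}) \<longlonglongrightarrow> 0" using assms by simp
  have null: "\<exists>s. 2 ^ i * card {\<tau>. length \<tau> = s \<and> \<tau> \<in> T} \<le> 2 ^ s" for i
  proof -
    obtain s where "measure lam {X. seg X s \<in> T} < 1 / 2 ^ i"
      using order_tendstoD(2)[OF lim, of "1 / 2 ^ i"] by (auto simp: eventually_sequentially)
    then have "real (2 ^ i * card {\<tau>. length \<tau> = s \<and> \<tau> \<in> T}) \<le> real (2 ^ s)"
      unfolding measure_seg[of "\<lambda>\<sigma>. \<sigma> \<in> T"] by (simp add: field_simps)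
    then show ?thesis unfolding of_nat_le_iff by blast
  qed
  show ?thesis
  proof (rule ccontr)
    assume "K \<inter> cyl \<rho> \<noteq> {}"
    then obtain X where X: "X \<in> K \<inter> cyl \<rho>" by blast
    then have "X \<notin> MLR" using paths by (intro null_tree_not_MLR[OF dec tree null]) auto
    then show False using X K_subset_MLR by blast
  qed
qed

text \<open>Membership in the complement of \<open>A\<close> is met by countably many conditions:
  for every \<open>i\<close>, some segment of length at least \<open>i\<close> has a child in
  \<open>W\<close>. If one of them were not dense, a whole cylinder would lie in \<open>K\<close>
  and be random.\<close>

lemma ex_not_A:
  assumes "E \<sigma>"
  obtains X where "X \<in> cyl \<sigma>" "\<And>n. E (seg X n)" "X \<notin> A"
proof -
  have "\<exists>\<tau>'. prefix \<tau> \<tau>' \<and> E \<tau>' \<and> (\<exists>\<upsilon> b. i \<le> length \<upsilon> \<and> prefix \<upsilon> \<tau>' \<and> \<upsilon> @ [b] \<in> W)" if "E \<tau>" for i \<tau>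
  proof (rule ccontr)
    assume no: "\<not> ?thesis"
    \<comment> \<open>Passing to a string of length at least \<open>i\<close> makes the failed
      condition apply to all of its extensions satisfying \<open>E\<close>.\<close>
    have "\<exists>\<tau>'. prefix \<tau> \<tau>' \<and> E \<tau>' \<and> n \<le> length \<tau>'" for n
    proof (induction n)
      case 0
      then show ?case using that by auto
    next
      case (Suc n)
      then obtain \<tau>' where "prefix \<tau> \<tau>'" "E \<tau>'" "n \<le> length \<tau>'" by blast
      moreover obtain b where "E (\<tau>' @ [b])" using E_extend \<open>E \<tau>'\<close> by blast
      ultimately show ?case by (intro exI[of _ "\<tau>' @ [b]"]) auto
    qed
    then obtain \<rho> where \<rho>: "prefix \<tau> \<rho>" "E \<rho>" "i \<le> length \<rho>" by blast
    \<comment> \<open>Bit by bit: the next string is outside \<open>W\<close>, so its cylinder meets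
      \<open>K\<close>, and then it does so in positive measure.\<close>
    have all: "E (\<rho> @ \<upsilon>)" for \<upsilon>
    proof (induction \<upsilon> rule: rev_induct)
      case (snoc b \<upsilon>)
      have "prefix \<tau> (\<rho> @ \<upsilon>)" using \<rho>(1) by simp
      then have "(\<rho> @ \<upsilon>) @ [b] \<notin> W" using no snoc \<rho>(3) by (metis length_append prefix_order.refl trans_le_add1)
      then have "K \<inter> cyl ((\<rho> @ \<upsilon>) @ [b]) \<noteq> {}" by (auto simp: W_def K_def)
      then have "measure lam (K \<inter> cyl ((\<rho> @ \<upsilon>) @ [b])) \<noteq> 0" using null_portion_empty by blast
      then show ?case using measure_nonneg[of lam] by (simp add: E_def less_le)
    qed (use \<rho> in simp)
    \<comment> \<open>\<open>\<rho>\<close> followed by zeros: it would be in \<open>K\<close>,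
      hence random.\<close>
    define X where "X n = (n < length \<rho> \<and> \<rho> ! n)" for n
    have "X \<in> cyl \<rho>" by (simp add: X_def cyl_def)
    have "seg X n \<notin> W" for n
    proof -
      have "prefix (seg X n) (seg X (length \<rho> + n))" by (simp add: prefix_seg_iff seg_mem_cyl)
      moreover have "prefix \<rho> (seg X (length \<rho> + n))" using \<open>X \<in> cyl \<rho>\<close> by (simp add: prefix_seg_iff)
      then have "E (seg X (length \<rho> + n))" using all by (auto simp: prefix_def)
      ultimately show ?thesis using E_imp_notin_W W_prefix by blast
    qed
    then have "X \<in> MLR" using K_subset_MLR mem_K_iff by blast
    then show False using eventually_zero_not_MLR[of "length \<rho>" X] by (simp add: X_def)
  qed
  note dense = this
  obtain X where X: "X \<in> cyl \<sigma>" "\<And>n. E (seg X n)"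
      "\<And>i. \<exists>n. \<exists>\<upsilon> b. i \<le> length \<upsilon> \<and> prefix \<upsilon> (seg X n) \<and> \<upsilon> @ [b] \<in> W"
    by (rule baire_strings[of E \<sigma> "\<lambda>i \<tau>. \<exists>\<upsilon> b. i \<le> length \<upsilon> \<and> prefix \<upsilon> \<tau> \<and> \<upsilon> @ [b] \<in> W"])
      (rule assms, erule (1) E_prefix, erule E_extend, erule dense, blast)
  have "\<exists>k\<ge>i. \<exists>b. seg X k @ [b] \<in> W" for i
    using X(3)[of i] unfolding prefix_seg_iff mem_cyl_iff by metis
  then have "X \<notin> A" unfolding A_def by blast
  then show thesis using that X by blast
qed

section \<open>Almost every member of \<open>K\<close> is in \<open>A\<close>\<close>

definition "child_W = {\<sigma>. \<sigma> \<notin> W \<and> (\<exists>b. \<sigma> @ [b] \<in> W)}"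

text \<open>A string outside \<open>W\<close> with a child in \<open>W\<close> loses at least half of its measure, so the measures
  of these strings telescope.\<close>
lemma card_child_W:
  "card {\<sigma>. length \<sigma> = k \<and> \<sigma> \<in> child_W} + card {\<sigma>. length \<sigma> = Suc k \<and> \<sigma> \<notin> W}
    \<le> 2 * card {\<sigma>. length \<sigma> = k \<and> \<sigma> \<notin> W}"
proof -
  let ?B = "{\<sigma>. length \<sigma> = k \<and> \<sigma> \<notin> W}" and ?C = "{\<sigma>. length \<sigma> = Suc k \<and> \<sigma> \<notin> W}"
    and ?D = "{\<sigma>. length \<sigma> = k \<and> \<sigma> \<in> child_W}"
  have "\<forall>\<sigma>\<in>child_W. \<exists>b. \<sigma> @ [b] \<in> W" by (simp add: child_W_def)
  from bchoice[OF this] obtain c where c: "\<And>\<sigma>. \<sigma> \<in> child_W \<Longrightarrow> \<sigma> @ [c \<sigma>] \<in> W" by blast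
  let ?h = "\<lambda>\<sigma>. \<sigma> @ [c \<sigma>]" and ?g = "\<lambda>(\<sigma>, b). \<sigma> @ [b :: bool]"
  \<comment> \<open>Among the one-bit extensions of strings outside \<open>W\<close>, those chosen
    by \<open>?h\<close> lie in \<open>W\<close> and those in \<open>?C\<close> do not, so they are
    counted separately.\<close>
  have sub: "?h ` ?D \<union> ?C \<subseteq> ?g ` (?B \<times> UNIV)"
  proof
    fix \<tau> assume "\<tau> \<in> ?h ` ?D \<union> ?C"
    then show "\<tau> \<in> ?g ` (?B \<times> UNIV)"
    proof
      assume "\<tau> \<in> ?h ` ?D"
      then show ?thesis by (auto simp: child_W_def)
    next
      assume \<tau>: "\<tau> \<in> ?C"
      then obtain \<sigma> b where \<sigma>: "\<tau> = \<sigma> @ [b]" by (metis (mono_tags, lifting) append_butlast_last_id length_0_conv mem_Collect_eq nat.distinct(1))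
      then have "\<sigma> \<notin> W" using \<tau> W_prefix[of \<sigma> \<tau>] by auto
      then have "(\<sigma>, b) \<in> ?B \<times> UNIV" using \<tau> \<sigma> by simp
      then show ?thesis using \<sigma> by force
    qed
  qed
  have fin: "finite ?D" "finite ?C" "finite (?B \<times> (UNIV :: bool set))" using finite_strings by auto
  have "card ?D + card ?C = card (?h ` ?D) + card ?C"
    by (subst card_image) (auto simp: inj_on_def)
  also have "\<dots> = card (?h ` ?D \<union> ?C)"
    using fin c by (subst card_Un_disjoint) auto
  also have "\<dots> \<le> card (?g ` (?B \<times> UNIV))"
    by (intro card_mono finite_imageI fin sub)
  also have "\<dots> \<le> card (?B \<times> (UNIV :: bool set))"
    by (intro card_image_le fin)
  also have "\<dots> = 2 * card ?B" by (simp add: card_cartesian_product)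
  finally show ?thesis .
qed

text \<open>The levels of \<open>child_W\<close> have total measure at most 2, since the bounds from
  \<open>card_child_W\<close> telescope; then Borel-Cantelli applies.\<close>

lemma AE_K_imp_A: "AE X in lam. X \<in> K \<longrightarrow> X \<in> A"
proof -
  let ?M = "\<lambda>k. {X. seg X k \<in> child_W}"
  define m where "m k = measure lam (?M k)" for k
  define n where "n k = measure lam {X. seg X k \<notin> W}" for k
  \<comment> \<open>The factor 2 on \<open>n (Suc k)\<close> arises because level
    \<open>k + 1\<close> has twice as many strings as level \<open>k\<close>.\<close>
  have m: "m k \<le> 2 * (n k - n (Suc k))" for k
  proof -
    have "real (card {\<sigma>. length \<sigma> = k \<and> \<sigma> \<in> child_W}) + real (card {\<sigma>. length \<sigma> = Suc k \<and> \<sigma> \<notin> W})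
      \<le> 2 * real (card {\<sigma>. length \<sigma> = k \<and> \<sigma> \<notin> W})"
      using of_nat_mono[OF card_child_W[of k], where ?'a = real] by simp
    then show ?thesis
      unfolding m_def n_def measure_seg[of "\<lambda>\<sigma>. \<sigma> \<in> child_W"] measure_seg[of "\<lambda>\<sigma>. \<sigma> \<notin> W"]
      by (simp add: field_simps)
  qed
  have "summable m"
  proof (rule summableI_nonneg_bounded)
    show "0 \<le> m k" for k by (simp add: m_def)
    have "(\<Sum>k<N. m k) \<le> 2 * (n 0 - n N)" for N
    proof (induction N)
      case (Suc N)
      then show ?case using m[of N] by simp
    qed simp
    moreover have "n 0 \<le> 1" "0 \<le> n N" for N by (simp_all add: n_def)
    ultimately show "(\<Sum>k<N. m k) \<le> 2" for N by (smt (verit))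
  qed
  then have "AE X in lam. eventually (\<lambda>k. X \<in> space lam - ?M k) sequentially"
    unfolding m_def using sets_seg[of "\<lambda>\<sigma>. \<sigma> \<in> child_W"]
    by (intro borel_cantelli_AE1) (auto simp: lam.emeasure_eq_measure)
  then show ?thesis
  proof eventually_elim
    case (elim X)
    then obtain N where "\<And>k. k \<ge> N \<Longrightarrow> seg X k \<notin> child_W" by (auto simp: eventually_sequentially)
    \<comment> \<open>Segments of a member of \<open>K\<close> are outside \<open>W\<close>, so not
      being in \<open>child_W\<close> means having no child in \<open>W\<close>.\<close>
    then show ?case unfolding child_W_def A_def using mem_K_iff by blast
  qed
qed

text \<open>The portion of \<open>K\<close> above \<open>\<sigma>\<close> is not null, so it
  contains a point outside the null set of \<open>AE_K_imp_A\<close>. All segments of that point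
  satisfy \<open>E\<close> by \<open>null_portion_empty\<close>.\<close>

lemma ex_A:
  assumes "E \<sigma>"
  obtains X where "X \<in> cyl \<sigma>" "\<And>n. E (seg X n)" "X \<in> A"
proof -
  have "AE X in lam. X \<in> K \<longrightarrow> X \<in> cyl \<tau> \<longrightarrow> E \<tau>" for \<tau>
  proof (cases "E \<tau>")
    case False
    then have "measure lam (K \<inter> cyl \<tau>) = 0" by (simp add: E_def not_less measure_le_0_iff)
    then have "K \<inter> cyl \<tau> = {}" by (rule null_portion_empty)
    then show ?thesis by auto
  qed simp
  then have "AE X in lam. \<forall>\<tau>. X \<in> K \<longrightarrow> X \<in> cyl \<tau> \<longrightarrow> E \<tau>"
    by (subst AE_all_countable) blast
  then have "AE X in lam. X \<in> K \<inter> cyl \<sigma> \<longrightarrow> (\<forall>n. E (seg X n)) \<and> X \<in> A"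
    using AE_K_imp_A by eventually_elim (use seg_mem_cyl in blast)
  moreover have "\<not> (AE X in lam. X \<notin> K \<inter> cyl \<sigma>)"
    using assms lam.prob_eq_0[OF sets_K_cyl, of \<sigma>] unfolding E_def by (metis less_irrefl)
  ultimately have "\<exists>X. X \<in> K \<inter> cyl \<sigma> \<and> (\<forall>n. E (seg X n)) \<and> X \<in> A"
    by (metis (mono_tags, lifting) AE_mp AE_I2)
  then show thesis using that by blast
qed

section \<open>Refuting a reduction\<close>

text \<open>Only those realizers of LAY matter that are undefined outside of the random sequences.\<close>
lemma reductionD:
  assumes red: "\<And>\<Gamma>. realizes delta_MLR delta_nat MLR_B (LAY U) \<Gamma> \<Longrightarrow>
      realizes delta_MLR delta_nat MLR_B (chi_restr A)
        (\<lambda>p. case TF \<Phi> p of None \<Rightarrow> None | Some p' \<Rightarrow>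
          (case \<Gamma> p' of None \<Rightarrow> None | Some r \<Rightarrow> TF \<Psi> (pairB p r)))"
    and X: "X \<in> MLR"
  obtains q where "TF \<Phi> (nat_seq X) = Some q" "to_cantor q \<in> MLR"
    "\<And>i. to_cantor q \<notin> U i \<Longrightarrow>
      TF \<Psi> (pairB (nat_seq X) (chi_nat i)) = Some (chi_nat (if X \<in> A then 1 else 0))"
proof -
  have "\<exists>i. to_cantor p \<notin> U i" if "p \<in> MLR_B" for p
    using that test_U unfolding MLR_B_def MLR_def by blast
  then obtain l where l: "\<And>p. p \<in> MLR_B \<Longrightarrow> to_cantor p \<notin> U (l p)" by metis
  have *: "\<exists>q. TF \<Phi> (nat_seq X) = Some q \<and> q \<in> MLR_B \<and>
      TF \<Psi> (pairB (nat_seq X) (chi_nat (l' q))) = Some (chi_nat (if X \<in> A then 1 else 0))"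
    if l': "\<And>p. p \<in> MLR_B \<Longrightarrow> to_cantor p \<notin> U (l' p)" for l'
  proof -
    \<comment> \<open>As this realizer is undefined outside \<open>MLR_B\<close>, the composition
      can only have a value if the output of \<open>\<Phi>\<close> is random.\<close>
    have "realizes delta_MLR delta_nat MLR_B (LAY U) (\<lambda>p. if p \<in> MLR_B then Some (chi_nat (l' p)) else None)"
      unfolding realizes_def delta_nat_eq_Some_iff LAY_def delta_MLR_def using l' by auto
    from red[OF this, unfolded realizes_def, rule_format, of "nat_seq X" "nat_seq X"] obtain r y
      where "(case TF \<Phi> (nat_seq X) of None \<Rightarrow> None | Some p' \<Rightarrow>
          (case if p' \<in> MLR_B then Some (chi_nat (l' p')) else None of
            None \<Rightarrow> None | Some r \<Rightarrow> TF \<Psi> (pairB (nat_seq X) r))) = Some r"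
        "delta_nat r = Some y" "y \<in> chi_restr A (nat_seq X)"
      using X by (auto simp: delta_MLR_def nat_seq_MLR_B)
    then show ?thesis
      unfolding delta_nat_eq_Some_iff chi_restr_def
      by (cases "TF \<Phi> (nat_seq X)") (simp_all split: if_splits)
  qed
  obtain q where q: "TF \<Phi> (nat_seq X) = Some q" "q \<in> MLR_B" using *[OF l] by blast
  show thesis
  proof (rule that[OF q(1)])
    show "to_cantor q \<in> MLR" using q(2) by (simp add: MLR_B_def)
    \<comment> \<open>Redefining the choice function at \<open>q\<close> to be \<open>i\<close>
      gives another realizer, so \<open>\<Psi>\<close> has to succeed with every correct
      layer.\<close>
    fix i assume "to_cantor q \<notin> U i"
    then show "TF \<Psi> (pairB (nat_seq X) (chi_nat i)) = Some (chi_nat (if X \<in> A then 1 else 0))"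
      using *[of "l(q := i)"] l q(1) by (auto split: if_splits)
  qed
qed

lemma no_reduction:
  "\<not> weihrauch_le delta_MLR delta_nat MLR_B (chi_restr A) delta_MLR delta_nat MLR_B (LAY U)"
proof
  assume "weihrauch_le delta_MLR delta_nat MLR_B (chi_restr A) delta_MLR delta_nat MLR_B (LAY U)"
  then obtain \<Phi> \<Psi> where red: "\<And>\<Gamma>. realizes delta_MLR delta_nat MLR_B (LAY U) \<Gamma> \<Longrightarrow>
      realizes delta_MLR delta_nat MLR_B (chi_restr A)
        (\<lambda>p. case TF \<Phi> p of None \<Rightarrow> None | Some p' \<Rightarrow>
          (case \<Gamma> p' of None \<Rightarrow> None | Some r \<Rightarrow> TF \<Psi> (pairB p r)))"
    unfolding weihrauch_le_def by blast
  \<comment> \<open>By \<open>null_portion_empty\<close> this is \<open>K\<close> again, now as the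
    set of paths to which \<open>baire_strings\<close> applies.\<close>
  define K' where "K' = {X. \<forall>n. E (seg X n)}"
  have K'_MLR: "X \<in> MLR" if "X \<in> K'" for X
    using that E_imp_notin_W mem_K_iff K_subset_MLR unfolding K'_def by blast
  have "\<forall>X. \<exists>q. X \<in> MLR \<longrightarrow> TF \<Phi> (nat_seq X) = Some q \<and> to_cantor q \<in> MLR \<and> (\<forall>i. to_cantor q \<notin> U i \<longrightarrow>
      TF \<Psi> (pairB (nat_seq X) (chi_nat i)) = Some (chi_nat (if X \<in> A then 1 else 0)))"
    using reductionD[OF red] by metis
  then obtain q where q: "\<And>X. X \<in> MLR \<Longrightarrow> TF \<Phi> (nat_seq X) = Some (q X)" "\<And>X. X \<in> MLR \<Longrightarrow> to_cantor (q X) \<in> MLR"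
    "\<And>X i. X \<in> MLR \<Longrightarrow> to_cantor (q X) \<notin> U i \<Longrightarrow>
      TF \<Psi> (pairB (nat_seq X) (chi_nat i)) = Some (chi_nat (if X \<in> A then 1 else 0))" by metis
  define D where "D i \<tau> \<longleftrightarrow> (\<forall>X\<in>K' \<inter> cyl \<tau>. to_cantor (q X) \<in> U i)" for i \<tau>
  \<comment> \<open>If every \<open>D i\<close> were dense, a path meeting all of them would be sent
    by \<open>\<Phi>\<close> into every \<open>U i\<close>, against the randomness of the
    output.\<close>
  have "\<exists>i \<sigma>. E \<sigma> \<and> (\<forall>\<tau>. prefix \<sigma> \<tau> \<longrightarrow> E \<tau> \<longrightarrow> \<not> D i \<tau>)"
  proof (rule ccontr)
    assume "\<not> ?thesis"
    then have "\<exists>\<tau>'. prefix \<tau> \<tau>' \<and> E \<tau>' \<and> D i \<tau>'" if "E \<tau>" for i \<tau> using that by blast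
    note dense = this
    obtain X where X: "X \<in> cyl []" "\<And>n. E (seg X n)" "\<And>i. \<exists>n. D i (seg X n)"
      by (rule baire_strings[of E "[]" D])
        (rule E_Nil, erule (1) E_prefix, erule E_extend, erule dense, blast)
    then have "X \<in> K'" by (simp add: K'_def)
    then have "to_cantor (q X) \<in> (\<Inter>i. U i)" using X(3) seg_mem_cyl[of X] unfolding D_def by blast
    then show False using q(2)[OF K'_MLR[OF \<open>X \<in> K'\<close>]] test_U unfolding MLR_def by blast
  qed
  then obtain i \<sigma> where \<sigma>: "E \<sigma>" "\<And>\<tau>. prefix \<sigma> \<tau> \<Longrightarrow> E \<tau> \<Longrightarrow> \<not> D i \<tau>" by blast
  \<comment> \<open>\<open>U i\<close> is open and \<open>\<Phi>\<close> continuous, so one output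
    in \<open>U i\<close> would put the outputs of a whole neighbourhood there and give a
    \<open>\<tau>\<close> above \<open>\<sigma>\<close> with \<open>D i \<tau>\<close>.\<close>
  have layer: "to_cantor (q X) \<notin> U i" if X: "X \<in> K'" "X \<in> cyl \<sigma>" for X
  proof
    assume qX: "to_cantor (q X) \<in> U i"
    have "open (U i)" using test_U by (simp add: MLtest_def)
    then obtain n where n: "cyl (seg (to_cantor (q X)) n) \<subseteq> U i" using qX by (rule open_contains_cyl)
    obtain m where m: "\<And>p' q' j. j < n \<Longrightarrow> \<forall>k<m. p' k = nat_seq X k \<Longrightarrow> TF \<Phi> p' = Some q' \<Longrightarrow> q' j = q X j"
      using TF_continuous[OF q(1)[OF K'_MLR[OF X(1)]], of n] by blast
    let ?\<tau> = "seg X (max m (length \<sigma>))"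
    have "D i ?\<tau>"
      unfolding D_def
    proof
      fix Y assume Y: "Y \<in> K' \<inter> cyl ?\<tau>"
      then have "\<forall>k<m. nat_seq Y k = nat_seq X k"
        using nat_seq_agree[of Y "max m (length \<sigma>)" X] by (simp add: mem_cyl_iff)
      then have "q Y j = q X j" if "j < n" for j
        using m[OF that _ q(1)[OF K'_MLR]] Y by blast
      then have "to_cantor (q Y) \<in> cyl (seg (to_cantor (q X)) n)"
        by (simp add: cyl_def seg_def to_cantor_def)
      then show "to_cantor (q Y) \<in> U i" using n by blast
    qed
    moreover have "prefix \<sigma> ?\<tau>" using X(2) by (simp add: prefix_seg_iff)
    ultimately show False using \<sigma>(2) X(1) unfolding K'_def by blast
  qed
  \<comment> \<open>Above \<open>\<sigma>\<close> the single answer \<open>i\<close> is always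
    correct, so \<open>\<Psi>\<close> with this answer decides \<open>A\<close> continuously
    there.\<close>
  obtain X where X: "X \<in> cyl \<sigma>" "X \<in> K'" "X \<in> A" using ex_A[OF \<sigma>(1)] unfolding K'_def by blast
  have X1: "TF \<Psi> (pairB (nat_seq X) (chi_nat i)) = Some (chi_nat 1)"
    using q(3)[OF K'_MLR[OF X(2)] layer[OF X(2,1)]] X(3) by simp
  \<comment> \<open>Position 1 separates the two names: \<open>chi_nat 1\<close> has value 1 there
    and \<open>chi_nat 0\<close> has value 0.\<close>
  obtain m where m: "\<And>p' q'. \<forall>k<m. p' k = pairB (nat_seq X) (chi_nat i) k \<Longrightarrow> TF \<Psi> p' = Some q' \<Longrightarrow> q' 1 = chi_nat 1 1"
    using TF_continuous[OF X1, of 2] by (metis one_less_numeral_iff semiring_norm(76))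
  let ?\<tau> = "seg X (max m (length \<sigma>))"
  have "E ?\<tau>" using X(2) by (simp add: K'_def)
  then obtain Y where Y: "Y \<in> cyl ?\<tau>" "Y \<in> K'" "Y \<notin> A" using ex_not_A unfolding K'_def by blast
  have "prefix \<sigma> ?\<tau>" using X(1) by (simp add: prefix_seg_iff)
  then have "Y \<in> cyl \<sigma>" using Y(1) cyl_antimono by blast
  then have "TF \<Psi> (pairB (nat_seq Y) (chi_nat i)) = Some (chi_nat 0)"
    using q(3)[OF K'_MLR[OF Y(2)] layer[OF Y(2)]] Y(3) by simp
  moreover have "\<forall>k<m. nat_seq Y k = nat_seq X k"
    using nat_seq_agree[of Y "max m (length \<sigma>)" X] Y(1) by (simp add: mem_cyl_iff)
  then have "\<forall>k<m. pairB (nat_seq Y) (chi_nat i) k = pairB (nat_seq X) (chi_nat i) k"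
    by (auto simp: pairB_def)
  ultimately have "chi_nat 0 1 = chi_nat 1 1" using m by blast
  then show False by (simp add: chi_nat_def)
qed

end

theorem theorem5p16:
  assumes "universal_MLtest U"
  shows "\<exists>A. Sigma02 A \<and>
    \<not> weihrauch_le delta_MLR delta_nat MLR_B (chi_restr A) delta_MLR delta_nat MLR_B (LAY U)"
proof -
  interpret universal_test U by unfold_locales (rule assms)
  show ?thesis using Sigma02_A no_reduction by blast
qed

end
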